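(* Let $G=([\ell],\mathcal{E})$ be a simple graph. The following are equivalent. (i) $G$ is a cocomparability graph and the ordering $1<2<\cdots<\ell$ is an umbrella-free ordering. (ii) The ordering $1<2<\cdots<\ell$ is an umbrella-free ordering of $G$. (iii) $\Psi(G)=\{\epsilon_i-\epsilon_j\mid\{i,j\}\in\mathcal{E},i<j\}\subseteq\Phi^+(A_{\ell-1})$ is Worpitzky-compatible (equivalently, strongly compatible). (iv) The chromatic polynomial of $G$ is $c_G(t)=t\sum_{k=1}^{\ell}f_k(G)\binom{t+\ell-1-k}{\ell-1}$. (v) $F_G(t)=Y_G(t)=(1-t)^\ell\sum_{q\ge1}\frac{c_G(q)}{q}t^q$; equivalently, $F_G(t)=Y_K(t)$ for any graph $K$ isomorphic to $G$. (vi) $W_G(t)=t(1-t)\frac{d}{dt}F_G(t)+t\ell F_G(t)$; equivalently, $w_k(G)=k f_k(G)+(\ell-k+1)f_{k-1}(G)$ for every $1\le k\le\ell$.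
   Context: Cocomparability graph: complement admits a transitive orientation. An ordering $v_1<\cdots<v_\ell$ is umbrella-free if whenever $i<k<j$ and $\{v_i,v_j\}\in\mathcal{E}$, then $\{v_i,v_k\}\in\mathcal{E}$ or $\{v_k,v_j\}\in\mathcal{E}$. Type $A_{\ell-1}$: $U=\{x\in\mathbb{R}^\ell\mid\sum x_i=0\}$, positive roots $\epsilon_i-\epsilon_j$ ($i<j$), simple roots $\alpha_i=\epsilon_i-\epsilon_{i+1}$, $H_{\alpha,m}=\{x\in U\mid(\alpha,x)=m\}$. An alcove is a connected component of $U\setminus\bigcup_{\alpha\in\Phi^+,m\in\mathbb{Z}}H_{\alpha,m}$; walls of $A$ support a facet of $A$; ceilings are walls not through the origin with the origin on the same side as $A$; $A^\diamondsuit$ is $A$ with its facets supported by ceilings; $P^\diamondsuit=\{x\in U\mid0<(\alpha_i,x)\le1\ \forall i\}$. $\Psi\subseteq\Phi^+$ is Worpitzky-compatible if for every alcove $A\subseteq P^\diamondsuit$, $\alpha\in\Psi$, $m\in\mathbb{Z}$, $A^\diamondsuit\cap H_{\alpha,m}$ is empty or contained in a ceiling $H_{\beta,m'}$ of $A$ with $\beta\in\Psi$; strongly compatible if for every $\alpha\in\Psi$ and positive roots $\beta_1,\dots,\beta_m$ with $\alpha\in\sum\mathbb{Z}_{>0}\beta_i$, some $\beta_k\in\Psi$. $c_G$ is the chromatic polynomial. $W_G(t)$ is defined by $\sum_{q\ge0}c_G(q)t^q=W_G(t)/(1-t)^{\ell+1}$ and $w_k(G)$ is its coefficient of $t^k$;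 $Y_G(t)$ is defined by $\sum_{q\ge1}\frac{c_G(q)}{q}t^q=Y_G(t)/(1-t)^\ell$. For $\pi\in\mathfrak{S}_\ell$, an $\mathcal{A}$-descent at $i\in[\ell]$ means $\pi_i>\pi_{i+1}$ and $\{\pi_i,\pi_{i+1}\}\notin\mathcal{E}$, with $\pi_{\ell+1}:=\pi_1$; $f_k(G)=\frac1\ell\#\{\pi\in\mathfrak{S}_\ell$ with exactly $\ell-k$ $\mathcal{A}$-descents$\}$ for $0\le k\le\ell$ (so $f_0(G)=0$), and $F_G(t)=\sum_{k=1}^\ell f_k(G)t^k$. *)

theory Defs
  imports
    "HOL-Analysis.Analysis"
    "HOL-Combinatorics.Permutations"
    "HOL-Computational_Algebra.Polynomial"
    "HOL-Computational_Algebra.Formal_Power_Series"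
begin

definition all_equivalent :: "bool list \<Rightarrow> bool" where
  "all_equivalent ps \<longleftrightarrow> (\<forall>p\<in>set ps. \<forall>q\<in>set ps. p \<longleftrightarrow> q)"


section \<open>Graphs\<close>

text \<open>A graph is a pair of a vertex set \<open>V\<close> and a set \<open>E\<close> of two-element subsets of \<open>V\<close>.\<close>

definition simple_graph :: "'v set \<Rightarrow> 'v set set \<Rightarrow> bool" where
  "simple_graph V E \<longleftrightarrow> finite V \<and> (\<forall>s\<in>E. s \<subseteq> V \<and> card s = 2)"

definition graph_isomorphic :: "'v set \<Rightarrow> 'v set set \<Rightarrow> 'w set \<Rightarrow> 'w set set \<Rightarrow> bool" where
  "graph_isomorphic V E V' E' \<longleftrightarrow>
     (\<exists>\<phi>. bij_betw \<phi> V V' \<and> (\<forall>u\<in>V. \<forall>v\<in>V. {u, v} \<in> E \<longleftrightarrow> {\<phi> u, \<phi> v} \<in> E'))"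

definition graph_complement :: "'v set \<Rightarrow> 'v set set \<Rightarrow> 'v set set" where
  "graph_complement V E = {s. s \<subseteq> V \<and> card s = 2 \<and> s \<notin> E}"

definition transitive_orientation :: "'v set \<Rightarrow> 'v set set \<Rightarrow> ('v \<times> 'v) set \<Rightarrow> bool" where
  "transitive_orientation V E R \<longleftrightarrow>
     R \<subseteq> V \<times> V \<and> asym R \<and> {{u, v} | u v. (u, v) \<in> R} = E \<and> trans R"

definition cocomparability_graph :: "'v set \<Rightarrow> 'v set set \<Rightarrow> bool" where
  "cocomparability_graph V E \<longleftrightarrow> (\<exists>R. transitive_orientation V (graph_complement V E) R)"

text \<open>An ordering of the vertices is given as the list of the vertices in increasing order.\<close>

definition umbrella_free_ordering :: "'v set \<Rightarrow> 'v set set \<Rightarrow> 'v list \<Rightarrow> bool" where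
  "umbrella_free_ordering V E vs \<longleftrightarrow>
     distinct vs \<and> set vs = V \<and>
     (\<forall>i k j. i < k \<and> k < j \<and> j < length vs \<and> {vs ! i, vs ! j} \<in> E \<longrightarrow>
        {vs ! i, vs ! k} \<in> E \<or> {vs ! k, vs ! j} \<in> E)"


section \<open>The chromatic polynomial and its generating functions\<close>

definition proper_colorings :: "'v set \<Rightarrow> 'v set set \<Rightarrow> nat \<Rightarrow> ('v \<Rightarrow> nat) set" where
  "proper_colorings V E q =
     {c \<in> V \<rightarrow>\<^sub>E {..<q}. \<forall>u\<in>V. \<forall>v\<in>V. {u, v} \<in> E \<longrightarrow> c u \<noteq> c v}"

definition chromatic_poly :: "'v set \<Rightarrow> 'v set set \<Rightarrow> real poly" where
  "chromatic_poly V E =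
     (THE p. \<forall>q. poly p (of_nat q) = of_nat (card (proper_colorings V E q)))"

text \<open>
  Below, \<open>card V\<close> plays the role of \<open>\<ell>\<close>. Since \<open>1 - t\<close> is a unit in the ring of formal power
  series, \<open>W\<^sub>G\<close> and \<open>Y\<^sub>G\<close> are obtained by multiplying their defining equations by the respective
  power of \<open>1 - t\<close>.
\<close>

definition W_series :: "'v set \<Rightarrow> 'v set set \<Rightarrow> real fps" where
  "W_series V E =
     (1 - fps_X) ^ (card V + 1) * Abs_fps (\<lambda>q. poly (chromatic_poly V E) (of_nat q))"

definition w_coeff :: "'v set \<Rightarrow> 'v set set \<Rightarrow> nat \<Rightarrow> real" where
  "w_coeff V E k = fps_nth (W_series V E) k"

definition Y_series :: "'v set \<Rightarrow> 'v set set \<Rightarrow> real fps" where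
  "Y_series V E =
     (1 - fps_X) ^ card V *
     Abs_fps (\<lambda>q. if q = 0 then 0 else poly (chromatic_poly V E) (of_nat q) / of_nat q)"


section \<open>Cyclic descents relative to a graph on \<open>{1..l}\<close>\<close>

definition A_descents :: "nat \<Rightarrow> nat set set \<Rightarrow> (nat \<Rightarrow> nat) \<Rightarrow> nat set" where
  "A_descents l E \<pi> =
     {i \<in> {1..l}. let next = (if i = l then 1 else i + 1)
                  in \<pi> i > \<pi> next \<and> {\<pi> i, \<pi> next} \<notin> E}"

definition f_coeff :: "nat \<Rightarrow> nat set set \<Rightarrow> nat \<Rightarrow> real" where
  "f_coeff l E k =
     of_nat (card {\<pi>. \<pi> permutes {1..l} \<and> card (A_descents l E \<pi>) + k = l}) / of_nat l"

definition F_series :: "nat \<Rightarrow> nat set set \<Rightarrow> real fps" where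
  "F_series l E = (\<Sum>k = 1..l. fps_const (f_coeff l E k) * fps_X ^ k)"


section \<open>The root system of type \<open>A\<close> and its affine hyperplane arrangement\<close>

text \<open>
  The ambient space is an arbitrary Euclidean space of dimension \<open>l\<close>, whose standard
  orthonormal basis is enumerated as \<open>\<epsilon> 1, \<dots>, \<epsilon> l\<close>; so \<open>x \<bullet> \<epsilon> i\<close> is the \<open>i\<close>-th coordinate of \<open>x\<close>.
\<close>

definition U_space :: "nat \<Rightarrow> (nat \<Rightarrow> 'a::euclidean_space) \<Rightarrow> 'a set" where
  "U_space l \<epsilon> = {x. (\<Sum>i = 1..l. x \<bullet> \<epsilon> i) = 0}"

definition pos_roots :: "nat \<Rightarrow> (nat \<Rightarrow> 'a::euclidean_space) \<Rightarrow> 'a set" where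
  "pos_roots l \<epsilon> = {\<epsilon> i - \<epsilon> j | i j. 1 \<le> i \<and> i < j \<and> j \<le> l}"

definition simple_root :: "(nat \<Rightarrow> 'a::euclidean_space) \<Rightarrow> nat \<Rightarrow> 'a" where
  "simple_root \<epsilon> i = \<epsilon> i - \<epsilon> (i + 1)"

definition hyperplane :: "nat \<Rightarrow> (nat \<Rightarrow> 'a::euclidean_space) \<Rightarrow> 'a \<Rightarrow> int \<Rightarrow> 'a set" where
  "hyperplane l \<epsilon> \<alpha> m = {x \<in> U_space l \<epsilon>. \<alpha> \<bullet> x = of_int m}"

definition affine_arrangement :: "nat \<Rightarrow> (nat \<Rightarrow> 'a::euclidean_space) \<Rightarrow> 'a set set" where
  "affine_arrangement l \<epsilon> = {hyperplane l \<epsilon> \<alpha> m | \<alpha> m. \<alpha> \<in> pos_roots l \<epsilon>}"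

definition alcoves :: "nat \<Rightarrow> (nat \<Rightarrow> 'a::euclidean_space) \<Rightarrow> 'a set set" where
  "alcoves l \<epsilon> = components (U_space l \<epsilon> - \<Union> (affine_arrangement l \<epsilon>))"

definition walls :: "nat \<Rightarrow> (nat \<Rightarrow> 'a::euclidean_space) \<Rightarrow> 'a set \<Rightarrow> 'a set set" where
  "walls l \<epsilon> A = {H \<in> affine_arrangement l \<epsilon>. (closure A \<inter> H) facet_of closure A}"

definition ceilings :: "nat \<Rightarrow> (nat \<Rightarrow> 'a::euclidean_space) \<Rightarrow> 'a set \<Rightarrow> 'a set set" where
  "ceilings l \<epsilon> A =
     {hyperplane l \<epsilon> \<alpha> m | \<alpha> m.
        \<alpha> \<in> pos_roots l \<epsilon> \<and> hyperplane l \<epsilon> \<alpha> m \<in> walls l \<epsilon> A \<and>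
        0 \<notin> hyperplane l \<epsilon> \<alpha> m \<and>
        (\<forall>x\<in>A. \<alpha> \<bullet> x < of_int m \<longleftrightarrow> \<alpha> \<bullet> 0 < of_int m)}"

text \<open>
  \<open>A\<^sup>\<diamondsuit>\<close> is the half-open simplex (the upper closure) that consists of \<open>A\<close> and its facets on
  ceilings, but without any point on a wall that is not a ceiling. These sets partition the
  half-open parallelepiped \<open>P\<^sup>\<diamondsuit>\<close>. Adding the closed facets would make the pieces overlap and
  leave \<open>P\<^sup>\<diamondsuit>\<close>; adding only the relative interiors would not cover \<open>P\<^sup>\<diamondsuit>\<close> and would make every
  \<open>\<Psi>\<close> Worpitzky-compatible.
\<close>

definition upper_closure :: "nat \<Rightarrow> (nat \<Rightarrow> 'a::euclidean_space) \<Rightarrow> 'a set \<Rightarrow> 'a set" where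
  "upper_closure l \<epsilon> A =
     A \<union> ((\<Union>H\<in>ceilings l \<epsilon> A. closure A \<inter> H) - \<Union> (walls l \<epsilon> A - ceilings l \<epsilon> A))"

definition P_half_open :: "nat \<Rightarrow> (nat \<Rightarrow> 'a::euclidean_space) \<Rightarrow> 'a set" where
  "P_half_open l \<epsilon> =
     {x \<in> U_space l \<epsilon>. \<forall>i\<in>{1..<l}. 0 < simple_root \<epsilon> i \<bullet> x \<and> simple_root \<epsilon> i \<bullet> x \<le> 1}"

definition Worpitzky_compatible ::
    "nat \<Rightarrow> (nat \<Rightarrow> 'a::euclidean_space) \<Rightarrow> 'a set \<Rightarrow> bool" where
  "Worpitzky_compatible l \<epsilon> \<Psi> \<longleftrightarrow>
     \<Psi> \<subseteq> pos_roots l \<epsilon> \<and>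
     (\<forall>A\<in>alcoves l \<epsilon>. A \<subseteq> P_half_open l \<epsilon> \<longrightarrow>
        (\<forall>\<alpha>\<in>\<Psi>. \<forall>m.
           upper_closure l \<epsilon> A \<inter> hyperplane l \<epsilon> \<alpha> m = {} \<or>
           (\<exists>\<beta>\<in>\<Psi>. \<exists>m'. hyperplane l \<epsilon> \<beta> m' \<in> ceilings l \<epsilon> A \<and>
              upper_closure l \<epsilon> A \<inter> hyperplane l \<epsilon> \<alpha> m \<subseteq> hyperplane l \<epsilon> \<beta> m')))"

definition strongly_compatible ::
    "nat \<Rightarrow> (nat \<Rightarrow> 'a::euclidean_space) \<Rightarrow> 'a set \<Rightarrow> bool" where
  "strongly_compatible l \<epsilon> \<Psi> \<longleftrightarrow>
     \<Psi> \<subseteq> pos_roots l \<epsilon> \<and>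
     (\<forall>\<alpha>\<in>\<Psi>. \<forall>(m::nat) (\<beta> :: nat \<Rightarrow> 'a) (c :: nat \<Rightarrow> int).
        (\<forall>k\<in>{1..m}. \<beta> k \<in> pos_roots l \<epsilon> \<and> c k > 0) \<and>
        \<alpha> = (\<Sum>k = 1..m. of_int (c k) *\<^sub>R \<beta> k) \<longrightarrow>
        (\<exists>k\<in>{1..m}. \<beta> k \<in> \<Psi>))"

definition Psi :: "nat \<Rightarrow> (nat \<Rightarrow> 'a::euclidean_space) \<Rightarrow> nat set set \<Rightarrow> 'a set" where
  "Psi l \<epsilon> E = {\<epsilon> i - \<epsilon> j | i j. 1 \<le> i \<and> i < j \<and> j \<le> l \<and> {i, j} \<in> E}"


section \<open>The chromatic polynomial is well defined\<close>

lemma card_proper_colorings_image: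
  assumes "finite S" "finite V"
  shows "card {c \<in> V \<rightarrow>\<^sub>E S. c ` V = S \<and> (\<forall>u\<in>V. \<forall>v\<in>V. {u, v} \<in> E \<longrightarrow> c u \<noteq> c v)}
       = card {c \<in> V \<rightarrow>\<^sub>E {..<card S}. c ` V = {..<card S} \<and>
                 (\<forall>u\<in>V. \<forall>v\<in>V. {u, v} \<in> E \<longrightarrow> c u \<noteq> c v)}"
  (is "card ?A = card ?B")
proof -
  obtain h where h: "bij_betw h S {..<card S}"
    using assms(1) ex_bij_betw_finite_nat[of S] by (auto simp: lessThan_atLeast0)
  define g where "g = inv_into S h"
  have hinj: "inj_on h S" and him: "h ` S = {..<card S}"
    using h by (auto simp: bij_betw_def)
  have g: "bij_betw g {..<card S} S"
    unfolding g_def using h by (rule bij_betw_inv_into)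
  have ginj: "inj_on g {..<card S}" and gim: "g ` {..<card S} = S"
    using g by (auto simp: bij_betw_def)
  have gh: "g (h x) = x" if "x \<in> S" for x
    unfolding g_def using hinj that by (rule inv_into_f_f)
  have hg: "h (g y) = y" if "y \<in> {..<card S}" for y
    unfolding g_def using him that by (intro f_inv_into_f) auto
  have "bij_betw (\<lambda>c. restrict (h \<circ> c) V) ?A ?B"
  proof (rule bij_betw_byWitness[where f' = "\<lambda>c. restrict (g \<circ> c) V"])
    show "\<forall>c\<in>?A. restrict (g \<circ> restrict (h \<circ> c) V) V = c"
      using gh by (auto simp: fun_eq_iff PiE_iff extensional_def restrict_def)
    show "\<forall>c\<in>?B. restrict (h \<circ> restrict (g \<circ> c) V) V = c"
      using hg by (auto simp: fun_eq_iff PiE_iff extensional_def restrict_def)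
    show "(\<lambda>c. restrict (h \<circ> c) V) ` ?A \<subseteq> ?B"
    proof clarify
      fix c assume c: "c \<in> V \<rightarrow>\<^sub>E c ` V" "S = c ` V"
        and p: "\<forall>u\<in>V. \<forall>v\<in>V. {u, v} \<in> E \<longrightarrow> c u \<noteq> c v"
      have "restrict (h \<circ> c) V ` V = h ` S" using c by auto
      moreover have "\<forall>u\<in>V. \<forall>v\<in>V. {u, v} \<in> E \<longrightarrow> h (c u) \<noteq> h (c v)"
        using p c hinj by (metis imageI inj_on_eq_iff)
      ultimately show "restrict (h \<circ> c) V \<in> V \<rightarrow>\<^sub>E {..<card (c ` V)} \<and>
          restrict (h \<circ> c) V ` V = {..<card (c ` V)} \<and>
          (\<forall>u\<in>V. \<forall>v\<in>V. {u, v} \<in> E \<longrightarrow> restrict (h \<circ> c) V u \<noteq> restrict (h \<circ> c) V v)"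
        using him c by auto
    qed
    show "(\<lambda>c. restrict (g \<circ> c) V) ` ?B \<subseteq> ?A"
    proof clarify
      fix c assume c: "c \<in> V \<rightarrow>\<^sub>E {..<card S}" "c ` V = {..<card S}"
        and p: "\<forall>u\<in>V. \<forall>v\<in>V. {u, v} \<in> E \<longrightarrow> c u \<noteq> c v"
      have "restrict (g \<circ> c) V ` V = g ` (c ` V)" by auto
      hence im: "restrict (g \<circ> c) V ` V = S" using c(2) gim by simp
      moreover have "\<forall>u\<in>V. \<forall>v\<in>V. {u, v} \<in> E \<longrightarrow> g (c u) \<noteq> g (c v)"
        using p c ginj by (metis imageI inj_on_eq_iff)
      ultimately show "restrict (g \<circ> c) V \<in> V \<rightarrow>\<^sub>E S \<and>
          restrict (g \<circ> c) V ` V = S \<and>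
          (\<forall>u\<in>V. \<forall>v\<in>V. {u, v} \<in> E \<longrightarrow> restrict (g \<circ> c) V u \<noteq> restrict (g \<circ> c) V v)"
        by auto
    qed
  qed
  thus ?thesis by (rule bij_betw_same_card)
qed

lemma chromatic_poly_exists:
  assumes fin: "finite V"
  shows "\<exists>p :: real poly. \<forall>q. poly p (of_nat q) = of_nat (card (proper_colorings V E q))"
proof -
  define Q where "Q c \<longleftrightarrow> (\<forall>u\<in>V. \<forall>v\<in>V. {u, v} \<in> E \<longrightarrow> c u \<noteq> c v)" for c :: "'a \<Rightarrow> nat"
  define b where "b k = card {c \<in> V \<rightarrow>\<^sub>E {..<k}. c ` V = {..<k} \<and> Q c}" for k
  have b0: "b k = 0" if "k > card V" for k
  proof -
    have "c ` V \<noteq> {..<k}" for c :: "'a \<Rightarrow> nat"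
      using card_image_le[OF fin, of c] that by auto
    thus ?thesis by (simp add: b_def)
  qed
  have count: "card (proper_colorings V E q) = (\<Sum>k\<le>card V. (q choose k) * b k)" for q
  proof -
    have eq: "proper_colorings V E q = (\<Union>S\<in>Pow {..<q}. {c \<in> V \<rightarrow>\<^sub>E S. c ` V = S \<and> Q c})"
      by (auto simp: proper_colorings_def Q_def PiE_iff)
    have "card (proper_colorings V E q)
        = (\<Sum>S\<in>Pow {..<q}. card {c \<in> V \<rightarrow>\<^sub>E S. c ` V = S \<and> Q c})"
      unfolding eq
    proof (rule card_UN_disjoint)
      show "\<forall>S\<in>Pow {..<q}. finite {c \<in> V \<rightarrow>\<^sub>E S. c ` V = S \<and> Q c}"
      proof
        fix S assume "S \<in> Pow {..<q}"
        hence "finite (V \<rightarrow>\<^sub>E S)" using fin by (intro finite_PiE) (auto intro: finite_subset)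
        thus "finite {c \<in> V \<rightarrow>\<^sub>E S. c ` V = S \<and> Q c}" by simp
      qed
    qed auto
    also have "\<dots> = (\<Sum>S\<in>Pow {..<q}. b (card S))"
    proof (rule sum.cong[OF refl])
      fix S assume "S \<in> Pow {..<q}"
      hence "finite S" by (auto intro: finite_subset)
      thus "card {c \<in> V \<rightarrow>\<^sub>E S. c ` V = S \<and> Q c} = b (card S)"
        unfolding b_def Q_def using card_proper_colorings_image[OF _ fin] by blast
    qed
    also have "\<dots> = (\<Sum>k\<le>q. \<Sum>S\<in>{S \<in> Pow {..<q}. card S = k}. b (card S))"
    proof (rule sum.group[symmetric])
      show "card ` Pow {..<q} \<subseteq> {..q}"
        using card_mono[of "{..<q}"] by fastforce
    qed auto
    also have "\<dots> = (\<Sum>k\<le>q. (q choose k) * b k)"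
    proof (rule sum.cong[OF refl])
      fix k
      have "card {S \<in> Pow {..<q}. card S = k} = q choose k"
        using n_subsets[of "{..<q}" k] by simp
      thus "(\<Sum>S\<in>{S \<in> Pow {..<q}. card S = k}. b (card S)) = (q choose k) * b k"
        by simp
    qed
    also have "\<dots> = (\<Sum>k\<le>card V. (q choose k) * b k)"
    proof -
      have "(\<Sum>k\<le>q. (q choose k) * b k) = (\<Sum>k\<le>max q (card V). (q choose k) * b k)"
        by (rule sum.mono_neutral_left) auto
      also have "\<dots> = (\<Sum>k\<le>card V. (q choose k) * b k)"
        by (rule sum.mono_neutral_right) (auto simp: b0)
      finally show ?thesis .
    qed
    finally show ?thesis .
  qed
  define p :: "real poly" where
    "p = (\<Sum>k\<le>card V. smult (of_nat (b k) / fact k) (\<Prod>i<k. [:- of_nat i, 1:]))"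
  have "poly p (of_nat q) = of_nat (card (proper_colorings V E q))" for q
  proof -
    have "poly p (of_nat q) = (\<Sum>k\<le>card V. of_nat (b k) * (of_nat q gchoose k))"
      by (simp add: p_def poly_sum poly_prod gbinomial_prod_rev lessThan_atLeast0)
    also have "\<dots> = of_nat (\<Sum>k\<le>card V. (q choose k) * b k)"
      by (simp add: binomial_gbinomial mult.commute)
    finally show ?thesis by (simp add: count)
  qed
  thus ?thesis by blast
qed

lemma poly_chromatic_poly:
  assumes "finite V"
  shows "poly (chromatic_poly V E) (of_nat q) = of_nat (card (proper_colorings V E q))"
proof -
  let ?P = "\<lambda>p :: real poly. \<forall>q. poly p (of_nat q) = of_nat (card (proper_colorings V E q))"
  have unique: "p = p'" if p: "?P p" and p': "?P p'" for p p'
  proof (rule ccontr)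
    assume "p \<noteq> p'"
    hence fin: "finite {x. poly (p - p') x = 0}" by (intro poly_roots_finite) simp
    have sub: "range (of_nat :: nat \<Rightarrow> real) \<subseteq> {x. poly (p - p') x = 0}"
      using p p' by (simp add: image_subset_iff)
    have "infinite (range (of_nat :: nat \<Rightarrow> real))"
      using range_inj_infinite[OF inj_of_nat] .
    thus False using finite_subset[OF sub fin] by contradiction
  qed
  obtain p where p: "?P p" using chromatic_poly_exists[OF assms] ..
  have "?P (chromatic_poly V E)"
    unfolding chromatic_poly_def using p unique[OF _ p] by (rule theI)
  thus ?thesis ..
qed

end

theory Submission
  imports Defs
begin

text \<open>
  Listing the vertices by colour, and each colour class decreasingly, assigns to every colouring a
  permutation \<open>\<pi>\<close> along which the colours increase weakly. For a proper colouring, consecutive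
  vertices of equal colour form an \<open>\<A>\<close>-descent. The number \<open>N(q)\<close> of all \<open>q\<close>-colourings with the
  latter property is therefore an upper bound for \<open>c\<^sub>G(q)\<close>. The two numbers agree for all \<open>q\<close> if the
  non-edges, oriented along \<open><\<close>, form a transitive relation, and they differ at \<open>q = l\<close> if there is
  an umbrella. Without any assumption on \<open>G\<close>,
  \<open>N(q) = \<Sum>\<^sub>\<pi> (q + des \<pi> choose l) = q \<Sum>\<^sub>k f\<^sub>k (q + l - 1 - k choose l - 1)\<close>, where the second
  equality averages over the cyclic rotations of \<open>\<pi>\<close>. Hence each of (iv), (v), (vi) says that
  \<open>c\<^sub>G = N\<close>.

  For the alcove of a generic point \<open>x\<close>, put \<open>K(u, v) = \<lfloor>x\<^sub>u - x\<^sub>v\<rfloor>\<close>. The walls are the hyperplanes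
  \<open>z\<^sub>u - z\<^sub>v = K(u, v)\<close> for which no \<open>w\<close> satisfies \<open>K(u, v) = K(u, w) + K(w, v)\<close>; for such a \<open>w\<close>, a
  point of the closed alcove on the hyperplane of \<open>(u, v)\<close> also lies on those of \<open>(u, w)\<close> and
  \<open>(w, v)\<close>. Points of \<open>A\<^sup>\<diamondsuit>\<close> only lie on hyperplanes with \<open>u > v\<close>, so splitting repeatedly an edge
  \<open>u > v\<close> of an umbrella-free graph ends in a ceiling that comes from an edge.
\<close>

section \<open>Umbrella-free orderings\<close>

definition umbrella_free :: "nat \<Rightarrow> nat set set \<Rightarrow> bool" where
  "umbrella_free l E \<longleftrightarrow>
     (\<forall>i k j. 1 \<le> i \<and> i < k \<and> k < j \<and> j \<le> l \<and> {i, j} \<in> E \<longrightarrow> {i, k} \<in> E \<or> {k, j} \<in> E)"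

lemma umbrella_freeD:
  "umbrella_free l E \<Longrightarrow> 1 \<le> i \<Longrightarrow> i < k \<Longrightarrow> k < j \<Longrightarrow> j \<le> l \<Longrightarrow> {i, j} \<in> E \<Longrightarrow>
     {i, k} \<in> E \<or> {k, j} \<in> E"
  unfolding umbrella_free_def by blast

lemma umbrella_free_ordering_upt:
  "umbrella_free_ordering {1..l} E [1..<l+1] \<longleftrightarrow> umbrella_free l E"
proof
  assume L: "umbrella_free_ordering {1..l} E [1..<l+1]"
  show "umbrella_free l E"
    unfolding umbrella_free_def
  proof (intro allI impI, elim conjE)
    fix i k j :: nat
    assume *: "1 \<le> i" "i < k" "k < j" "j \<le> l" "{i, j} \<in> E"
    have nth: "[1..<l+1] ! (m - 1) = m" if "1 \<le> m" "m \<le> l" for m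
      using that by (simp del: upt_Suc)
    have "i - 1 < k - 1 \<and> k - 1 < j - 1 \<and> j - 1 < length [1..<l+1] \<and>
        {[1..<l+1] ! (i - 1), [1..<l+1] ! (j - 1)} \<in> E"
      using * nth[of i] nth[of j] by (auto simp del: upt_Suc)
    hence "{[1..<l+1] ! (i - 1), [1..<l+1] ! (k - 1)} \<in> E \<or>
        {[1..<l+1] ! (k - 1), [1..<l+1] ! (j - 1)} \<in> E"
      using L unfolding umbrella_free_ordering_def by blast
    thus "{i, k} \<in> E \<or> {k, j} \<in> E"
      using * nth[of i] nth[of j] nth[of k] by (simp del: upt_Suc)
  qed
next
  assume R: "umbrella_free l E"
  show "umbrella_free_ordering {1..l} E [1..<l+1]"
    unfolding umbrella_free_ordering_def
  proof (intro conjI allI impI, goal_cases)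
    case (3 i k j)
    hence "i < k" "k < j" "j < l" "{Suc i, Suc j} \<in> E" by (auto simp del: upt_Suc)
    thus ?case using umbrella_freeD[OF R, of "Suc i" "Suc k" "Suc j"] by (simp del: upt_Suc)
  qed auto
qed

text \<open>Read contrapositively, the umbrella condition says that the non-edges, oriented upwards,
  form a transitive relation.\<close>

lemma cocomparability_if_umbrella_free:
  assumes "umbrella_free l E"
  shows "cocomparability_graph {1..l} E"
proof -
  let ?R = "{(i, j). 1 \<le> i \<and> i < j \<and> j \<le> l \<and> {i, j} \<notin> E}"
  have "transitive_orientation {1..l} (graph_complement {1..l} E) ?R"
    unfolding transitive_orientation_def
  proof (intro conjI)
    show "?R \<subseteq> {1..l} \<times> {1..l}" by auto
    show "asym ?R" by (auto intro!: asymI)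
    show "{{u, v} |u v. (u, v) \<in> ?R} = graph_complement {1..l} E"
    proof (intro equalityI subsetI)
      fix s assume "s \<in> {{u, v} |u v. (u, v) \<in> ?R}"
      thus "s \<in> graph_complement {1..l} E"
        by (auto simp: graph_complement_def)
    next
      fix s assume s: "s \<in> graph_complement {1..l} E"
      then obtain u v where uv: "s = {u, v}" "u \<noteq> v"
        unfolding graph_complement_def card_2_iff by blast
      have "s = {min u v, max u v}" "(min u v, max u v) \<in> ?R"
        using s uv by (auto simp: graph_complement_def min_def max_def insert_commute)
      thus "s \<in> {{u, v} |u v. (u, v) \<in> ?R}" by blast
    qed
    show "trans ?R"
      using umbrella_freeD[OF assms] by (intro transI) (clarsimp, meson less_trans order.trans)
  qed
  thus ?thesis unfolding cocomparability_graph_def by blast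
qed

section \<open>Colourings along a permutation\<close>

definition weak_chains :: "nat \<Rightarrow> nat set \<Rightarrow> nat \<Rightarrow> (nat \<Rightarrow> nat) set" where
  "weak_chains n D q =
     {g \<in> {1..n} \<rightarrow>\<^sub>E {..<q}. \<forall>i\<in>{1..<n}. g i < g (Suc i) \<or> i \<in> D \<and> g i = g (Suc i)}"

lemma finite_weak_chains [simp]: "finite (weak_chains n D q)"
  unfolding weak_chains_def by (simp add: finite_PiE)

lemma weak_chains_mono:
  assumes "g \<in> weak_chains n D q" "1 \<le> i" "i \<le> j" "j \<le> n"
  shows "g i \<le> g j"
  using assms(3,4)
proof (induction j rule: dec_induct)
  case (step j)
  hence "j \<in> {1..<n}" using assms(2) by simp
  moreover have "\<forall>i\<in>{1..<n}. g i < g (Suc i) \<or> i \<in> D \<and> g i = g (Suc i)"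
    using assms(1) by (simp add: weak_chains_def)
  ultimately have "g j \<le> g (Suc j)" by fastforce
  with step show ?case by auto
qed simp

text \<open>Once the last entry is the top colour \<open>q\<close>, its predecessor may also be
  \<open>q\<close> exactly if a tie is permitted at \<open>n\<close>; this fixes how many colours
  remain for the prefix.\<close>

lemma weak_chains_last:
  assumes "0 \<notin> D"
  shows "card {g \<in> weak_chains (Suc n) D (Suc q). g (Suc n) = q}
       = card (weak_chains n D (if n \<in> D then Suc q else q))"
proof -
  let ?q = "if n \<in> D then Suc q else q"
  have "bij_betw (\<lambda>g. g(Suc n := q)) (weak_chains n D ?q) {g \<in> weak_chains (Suc n) D (Suc q). g (Suc n) = q}"
  proof (rule bij_betw_byWitness[where f' = "\<lambda>g. g(Suc n := undefined)"])
    show "\<forall>g\<in>weak_chains n D ?q. (g(Suc n := q))(Suc n := undefined) = g"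
      by (auto simp: weak_chains_def PiE_iff extensional_def fun_eq_iff)
    show "\<forall>g\<in>{g \<in> weak_chains (Suc n) D (Suc q). g (Suc n) = q}. (g(Suc n := undefined))(Suc n := q) = g"
      by auto
    show "(\<lambda>g. g(Suc n := q)) ` weak_chains n D ?q \<subseteq> {g \<in> weak_chains (Suc n) D (Suc q). g (Suc n) = q}"
    proof clarify
      fix g assume g: "g \<in> weak_chains n D ?q"
      have b: "g i < ?q" if "i \<in> {1..n}" for i using g that by (auto simp: weak_chains_def PiE_iff)
      have "g(Suc n := q) \<in> {1..Suc n} \<rightarrow>\<^sub>E {..<Suc q}"
        using g by (auto simp: weak_chains_def PiE_iff extensional_def split: if_splits)
          (metis atLeastAtMost_iff le_antisym less_SucI not_less_eq_eq)
      moreover have "(g(Suc n := q)) i < (g(Suc n := q)) (Suc i) \<or> i \<in> D \<and> (g(Suc n := q)) i = (g(Suc n := q)) (Suc i)"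
        if i: "i \<in> {1..<Suc n}" for i
      proof (cases "i = n")
        case True
        thus ?thesis using b[of n] i by (auto split: if_splits)
      next
        case False
        thus ?thesis using g i by (auto simp: weak_chains_def)
      qed
      ultimately show "g(Suc n := q) \<in> weak_chains (Suc n) D (Suc q) \<and> (g(Suc n := q)) (Suc n) = q"
        by (auto simp: weak_chains_def)
    qed
    show "(\<lambda>g. g(Suc n := undefined)) ` {g \<in> weak_chains (Suc n) D (Suc q). g (Suc n) = q} \<subseteq> weak_chains n D ?q"
    proof (intro image_subsetI, elim CollectE conjE)
      fix g assume g: "g \<in> weak_chains (Suc n) D (Suc q)" and gq: "g (Suc n) = q"
      have "g i < ?q" if i: "i \<in> {1..n}" for i
      proof -
        have "g i \<le> g n" using weak_chains_mono[OF g, of i n] i by auto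
        moreover have "g n < g (Suc n) \<or> n \<in> D \<and> g n = g (Suc n)" using g i by (auto simp: weak_chains_def)
        ultimately show ?thesis using gq by auto
      qed
      thus "g(Suc n := undefined) \<in> weak_chains n D ?q"
        using g gq by (auto simp: weak_chains_def PiE_iff extensional_def)
    qed
  qed
  thus ?thesis by (rule bij_betw_same_card[symmetric])
qed

text \<open>Induction on the length, then on the number of colours: splitting by whether the last
  entry is the top colour gives Pascal's rule. Each permitted tie acts like one additional
  colour.\<close>

lemma card_weak_chains:
  assumes "0 \<notin> D"
  shows "card (weak_chains n D q) = (q + card (D \<inter> {..<n})) choose n"
proof (induction n arbitrary: q)
  case 0
  have "weak_chains 0 D q = {\<lambda>_. undefined}" by (auto simp: weak_chains_def)
  thus ?case by simp
next
  case (Suc n)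
  note IH = Suc.IH
  let ?d = "card (D \<inter> {..<Suc n})"
  have d: "?d = card (D \<inter> {..<n}) + (if n \<in> D then 1 else 0)"
    by (simp add: lessThan_Suc)
  \<comment> \<open>Without colours there is no chain, and the binomial vanishes because at most
    \<open>n\<close> ties are permitted. This is where \<open>0 \<notin> D\<close> enters.\<close>
  have dle: "?d \<le> n"
  proof -
    have "D \<inter> {..<Suc n} \<subseteq> {1..n}" using assms by (auto simp: Suc_le_eq intro: gr0I)
    from card_mono[OF _ this] show ?thesis by simp
  qed
  show ?case
  proof (induction q)
    case 0
    have "weak_chains (Suc n) D 0 = {}" by (auto simp: weak_chains_def PiE_iff)
    thus ?case using dle by (simp add: binomial_eq_0)
  next
    case (Suc q)
    have "weak_chains (Suc n) D (Suc q)
        = weak_chains (Suc n) D q \<union> {g \<in> weak_chains (Suc n) D (Suc q). g (Suc n) = q}"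
    proof (intro equalityI subsetI)
      fix g assume g: "g \<in> weak_chains (Suc n) D (Suc q)"
      show "g \<in> weak_chains (Suc n) D q \<union> {g \<in> weak_chains (Suc n) D (Suc q). g (Suc n) = q}"
      proof (cases "g (Suc n) = q")
        case False
        have "g (Suc n) < Suc q" using g by (auto simp: weak_chains_def PiE_iff)
        hence "g i < q" if "i \<in> {1..Suc n}" for i
          using weak_chains_mono[OF g, of i "Suc n"] that False by force
        hence "g \<in> weak_chains (Suc n) D q" using g by (auto simp: weak_chains_def PiE_iff)
        thus ?thesis by blast
      qed (use g in auto)
    next
      fix g assume "g \<in> weak_chains (Suc n) D q \<union> {g \<in> weak_chains (Suc n) D (Suc q). g (Suc n) = q}"
      thus "g \<in> weak_chains (Suc n) D (Suc q)" by (auto simp: weak_chains_def PiE_iff less_SucI)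
    qed
    moreover have "weak_chains (Suc n) D q \<inter> {g \<in> weak_chains (Suc n) D (Suc q). g (Suc n) = q} = {}"
      by (auto simp: weak_chains_def PiE_iff)
    ultimately have "card (weak_chains (Suc n) D (Suc q)) = card (weak_chains (Suc n) D q)
        + card {g \<in> weak_chains (Suc n) D (Suc q). g (Suc n) = q}"
      by (metis (no_types, lifting) card_Un_disjoint finite_weak_chains finite_Collect_conjI finite_Un)
    also have "card {g \<in> weak_chains (Suc n) D (Suc q). g (Suc n) = q}
        = (q + ?d) choose n"
      using assms d IH by (subst weak_chains_last) (auto split: if_splits)
    also have "card (weak_chains (Suc n) D q) = (q + ?d) choose Suc n" using Suc.IH .
    finally show ?case by simp
  qed
qed

definition colorings_along :: "nat \<Rightarrow> nat set set \<Rightarrow> (nat \<Rightarrow> nat) \<Rightarrow> nat \<Rightarrow> (nat \<Rightarrow> nat) set" where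
  "colorings_along l E \<pi> q =
     {c \<in> {1..l} \<rightarrow>\<^sub>E {..<q}. \<forall>i\<in>{1..<l}. c (\<pi> i) < c (\<pi> (Suc i)) \<or>
        i \<in> A_descents l E \<pi> \<and> c (\<pi> i) = c (\<pi> (Suc i))}"

lemma finite_colorings_along [simp]: "finite (colorings_along l E \<pi> q)"
  unfolding colorings_along_def by (simp add: finite_PiE)

lemma A_descents_less: "i \<in> {1..<l} \<Longrightarrow>
    i \<in> A_descents l E \<pi> \<longleftrightarrow> \<pi> i > \<pi> (Suc i) \<and> {\<pi> i, \<pi> (Suc i)} \<notin> E"
  by (auto simp: A_descents_def Let_def)

lemma A_descents_subset: "A_descents l E \<pi> \<subseteq> {1..l}"
  by (auto simp: A_descents_def)

text \<open>Composition with \<pi> yields weak chains. These only look at positions below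
  \<open>l\<close>, so a cyclic descent at \<open>l\<close> drops out of the count.\<close>

lemma card_colorings_along:
  assumes "\<pi> permutes {1..l}"
  shows "card (colorings_along l E \<pi> q) = (q + card (A_descents l E \<pi> - {l})) choose l"
proof -
  let ?inv = "inv \<pi>"
  let ?D = "A_descents l E \<pi>"
  have p: "\<pi> i \<in> {1..l} \<longleftrightarrow> i \<in> {1..l}" for i using permutes_in_image[OF assms] .
  have p': "?inv i \<in> {1..l} \<longleftrightarrow> i \<in> {1..l}" for i
    using permutes_in_image[OF permutes_inv[OF assms]] .
  have inv: "\<pi> (?inv i) = i" "?inv (\<pi> i) = i" for i
    using permutes_inverses[OF assms] by auto
  have "bij_betw (\<lambda>c. restrict (c \<circ> \<pi>) {1..l}) (colorings_along l E \<pi> q) (weak_chains l ?D q)"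
  proof (rule bij_betw_byWitness[where f' = "\<lambda>g. restrict (g \<circ> ?inv) {1..l}"])
    show "\<forall>c\<in>colorings_along l E \<pi> q. restrict (restrict (c \<circ> \<pi>) {1..l} \<circ> ?inv) {1..l} = c"
      using p' inv by (auto simp: colorings_along_def fun_eq_iff PiE_iff extensional_def restrict_def)
    show "\<forall>g\<in>weak_chains l ?D q. restrict (restrict (g \<circ> ?inv) {1..l} \<circ> \<pi>) {1..l} = g"
      using p inv by (auto simp: weak_chains_def fun_eq_iff PiE_iff extensional_def restrict_def)
    show "(\<lambda>c. restrict (c \<circ> \<pi>) {1..l}) ` colorings_along l E \<pi> q \<subseteq> weak_chains l ?D q"
    proof (rule image_subsetI)
      fix c assume c: "c \<in> colorings_along l E \<pi> q"
      hence "c (\<pi> i) < q" if "i \<in> {1..l}" for i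
        using that p[of i] unfolding colorings_along_def PiE_iff by blast
      moreover have "\<forall>i\<in>{1..<l}. c (\<pi> i) < c (\<pi> (Suc i)) \<or> i \<in> ?D \<and> c (\<pi> i) = c (\<pi> (Suc i))"
        using c by (simp add: colorings_along_def)
      ultimately show "restrict (c \<circ> \<pi>) {1..l} \<in> weak_chains l ?D q"
        by (simp add: weak_chains_def PiE_iff)
    qed
    show "(\<lambda>g. restrict (g \<circ> ?inv) {1..l}) ` weak_chains l ?D q \<subseteq> colorings_along l E \<pi> q"
    proof (rule image_subsetI)
      fix g assume g: "g \<in> weak_chains l ?D q"
      hence "g (?inv i) < q" if "i \<in> {1..l}" for i
        using that p'[of i] unfolding weak_chains_def PiE_iff by blast
      moreover have "\<forall>i\<in>{1..<l}. g i < g (Suc i) \<or> i \<in> ?D \<and> g i = g (Suc i)"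
        using g by (simp add: weak_chains_def)
      moreover have "restrict (g \<circ> ?inv) {1..l} (\<pi> i) = g i" if "i \<in> {1..l}" for i
        using p[of i] that by (simp add: inv del: atLeastAtMost_iff)
      ultimately show "restrict (g \<circ> ?inv) {1..l} \<in> colorings_along l E \<pi> q"
        by (simp add: colorings_along_def PiE_iff)
    qed
  qed
  hence "card (colorings_along l E \<pi> q) = card (weak_chains l ?D q)"
    by (rule bij_betw_same_card)
  also have "\<dots> = (q + card (?D \<inter> {..<l})) choose l"
    using A_descents_subset[of l E \<pi>] by (intro card_weak_chains) auto
  also have "?D \<inter> {..<l} = ?D - {l}"
    using A_descents_subset[of l E \<pi>] by fastforce
  finally show ?thesis .
qed

section \<open>Sorting the vertices by colour\<close>

text \<open>Ordering the vertices by this key sorts them by colour, and each colour class decreasingly.\<close>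

definition color_key :: "nat \<Rightarrow> (nat \<Rightarrow> nat) \<Rightarrow> nat \<Rightarrow> nat" where
  "color_key l c v = c v * Suc l + (l - v)"

text \<open>The summand \<open>l - v\<close> is less than \<open>Suc l\<close>, so colours are
  compared first and labels only break ties.\<close>

lemma color_key_less_iff:
  assumes "u \<le> l" "v \<le> l"
  shows "color_key l c u < color_key l c v \<longleftrightarrow> c u < c v \<or> c u = c v \<and> v < u"
proof -
  have *: "color_key l c u < color_key l c v" if "c u < c v" for u v
  proof -
    have "color_key l c u < c u * Suc l + Suc l" by (simp add: color_key_def)
    also have "\<dots> = Suc (c u) * Suc l" by simp
    also have "\<dots> \<le> c v * Suc l" using that by (intro mult_le_mono1) simp
    finally show ?thesis by (simp add: color_key_def)
  qed
  consider "c u < c v" | "c v < c u" | "c u = c v" by linarith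
  thus ?thesis
  proof cases
    case 1 thus ?thesis using * by simp
  next
    case 2 thus ?thesis using *[of v u] by simp
  next
    case 3 thus ?thesis using assms by (auto simp: color_key_def)
  qed
qed

lemma inj_on_color_key: "inj_on (color_key l c) {1..l}"
proof (rule linorder_inj_onI')
  fix u v assume "u \<in> {1..l}" "v \<in> {1..l}" "u < v"
  thus "color_key l c u \<noteq> color_key l c v"
    using color_key_less_iff[of u l v c] color_key_less_iff[of v l u c] by auto
qed

lemma strict_sorted_color_key:
  assumes c: "c \<in> colorings_along l E \<pi> q" and \<pi>: "\<pi> permutes {1..l}"
  shows "sorted_wrt (<) (map (color_key l c \<circ> \<pi>) [1..<Suc l])"
  unfolding sorted_wrt_iff_nth_Suc_transp[OF transp_on_less]
proof (intro allI impI)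
  fix i assume "Suc i < length (map (color_key l c \<circ> \<pi>) [1..<Suc l])"
  hence i: "Suc i \<in> {1..<l}" by (simp del: upt_Suc)
  have "\<pi> (Suc i) \<in> {1..l}" "\<pi> (Suc (Suc i)) \<in> {1..l}"
    using permutes_in_image[OF \<pi>] i by auto
  moreover have "c (\<pi> (Suc i)) < c (\<pi> (Suc (Suc i))) \<or>
      Suc i \<in> A_descents l E \<pi> \<and> c (\<pi> (Suc i)) = c (\<pi> (Suc (Suc i)))"
    using c i unfolding colorings_along_def by blast
  ultimately have "color_key l c (\<pi> (Suc i)) < color_key l c (\<pi> (Suc (Suc i)))"
    using A_descents_less[OF i, of E \<pi>] by (subst color_key_less_iff) auto
  thus "map (color_key l c \<circ> \<pi>) [1..<Suc l] ! i < map (color_key l c \<circ> \<pi>) [1..<Suc l] ! Suc i"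
    using i by (simp del: upt_Suc)
qed

text \<open>The permutation must list the vertices by strictly increasing key, and a strictly sorted
  list is determined by its set.\<close>

lemma colorings_along_disjoint:
  assumes c: "c \<in> colorings_along l E \<pi> q" "c \<in> colorings_along l E \<sigma> q"
    and \<pi>: "\<pi> permutes {1..l}" and \<sigma>: "\<sigma> permutes {1..l}"
  shows "\<pi> = \<sigma>"
proof -
  have im: "\<pi> ` {1..l} = {1..l}" "\<sigma> ` {1..l} = {1..l}"
    using permutes_image[OF \<pi>] permutes_image[OF \<sigma>] by auto
  have set: "set [1..<Suc l] = {1..l}" by auto
  have "map (color_key l c \<circ> \<pi>) [1..<Suc l] = map (color_key l c \<circ> \<sigma>) [1..<Suc l]"
    by (rule strict_sorted_equal[OF strict_sorted_color_key[OF c(2) \<sigma>] strict_sorted_color_key[OF c(1) \<pi>]])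
      (simp only: set_map set image_comp[symmetric] im)
  hence "color_key l c (\<pi> i) = color_key l c (\<sigma> i)" if "i \<in> {1..l}" for i
    using that set by (simp only: map_eq_conv o_def)
  hence "\<pi> i = \<sigma> i" if "i \<in> {1..l}" for i
    using that inj_onD[OF inj_on_color_key, of l c "\<pi> i" "\<sigma> i"]
      permutes_in_image[OF \<pi>] permutes_in_image[OF \<sigma>] by blast
  moreover have "\<pi> i = \<sigma> i" if "i \<notin> {1..l}" for i
    using that permutes_not_in[OF \<pi>] permutes_not_in[OF \<sigma>] by metis
  ultimately show ?thesis by blast
qed

text \<open>The permutation sorts the vertices by \<open>color_key\<close>. Consecutive vertices of
  equal colour are then neighbours in their colour class, and \<open>consec\<close> is stated for
  exactly those pairs.\<close>

lemma ex_colorings_along: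
  assumes c: "c \<in> {1..l} \<rightarrow>\<^sub>E {..<q}"
    and consec: "\<And>u v. u \<in> {1..l} \<Longrightarrow> v < u \<Longrightarrow> 1 \<le> v \<Longrightarrow> c u = c v \<Longrightarrow>
       (\<And>w. v < w \<Longrightarrow> w < u \<Longrightarrow> c w \<noteq> c u) \<Longrightarrow> {u, v} \<notin> E"
  shows "\<exists>\<pi>. \<pi> permutes {1..l} \<and> c \<in> colorings_along l E \<pi> q"
proof -
  define key where "key = color_key l c"
  \<comment> \<open>\<open>h\<close> lists the keys increasingly from index 0, hence the
    \<open>i - 1\<close> in \<open>g\<close> below.\<close>
  obtain h where h: "bij_betw h {..<card (key ` {1..l})} (key ` {1..l})"
      "strict_mono_on {..<card (key ` {1..l})} h"
    using ex_bij_betw_strict_mono_card[of "key ` {1..l}"] by blast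
  have card: "card (key ` {1..l}) = l"
    using card_image[OF inj_on_color_key, of l c] by (simp add: key_def)
  have key: "bij_betw key {1..l} (key ` {1..l})"
    using inj_on_color_key by (simp add: key_def bij_betw_def)
  define g where "g i = inv_into {1..l} key (h (i - 1))" for i
  have sub: "bij_betw (\<lambda>i. i - 1) {1..l} {..<l}"
    by (rule bij_betw_byWitness[where f' = Suc]) auto
  have "bij_betw g {1..l} {1..l}"
    unfolding g_def
    using bij_betw_trans[OF bij_betw_trans[OF sub h(1)[unfolded card]] bij_betw_inv_into[OF key]]
    by (simp add: o_def)
  then obtain \<pi> where \<pi>: "\<pi> permutes {1..l}" "\<And>i. i \<in> {1..l} \<Longrightarrow> \<pi> i = g i"
  proof -
    assume bij: "bij_betw g {1..l} {1..l}"
      and that: "\<And>\<pi>. \<pi> permutes {1..l} \<Longrightarrow> (\<And>i. i \<in> {1..l} \<Longrightarrow> \<pi> i = g i) \<Longrightarrow> thesis"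
    have "bij_betw (\<lambda>i. if i \<in> {1..l} then g i else i) {1..l} {1..l}"
      by (rule iffD1[OF bij_betw_cong bij]) auto
    hence "(\<lambda>i. if i \<in> {1..l} then g i else i) permutes {1..l}"
      by (rule bij_imp_permutes) auto
    thus thesis by (rule that) auto
  qed
  have key\<pi>: "key (\<pi> i) = h (i - 1)" if "i \<in> {1..l}" for i
  proof -
    have "h (i - 1) \<in> key ` {1..l}"
      using h(1) that unfolding card bij_betw_def by force
    thus ?thesis using \<pi>(2)[OF that] by (simp add: g_def f_inv_into_f)
  qed
  have mono: "key (\<pi> i) < key (\<pi> j) \<longleftrightarrow> i < j" if "i \<in> {1..l}" "j \<in> {1..l}" for i j
  proof -
    have "i - 1 < l" "j - 1 < l" using that by auto
    hence "h (i - 1) < h (j - 1) \<longleftrightarrow> i - 1 < j - 1"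
      using strict_mono_on_less[OF h(2)] card by simp
    thus ?thesis using that key\<pi> by auto
  qed
  have in': "\<pi> i \<in> {1..l} \<longleftrightarrow> i \<in> {1..l}" for i using permutes_in_image[OF \<pi>(1)] .
  have keyiff: "key u < key v \<longleftrightarrow> c u < c v \<or> c u = c v \<and> v < u"
    if "u \<in> {1..l}" "v \<in> {1..l}" for u v
    using that unfolding key_def by (intro color_key_less_iff) auto
  have "c (\<pi> i) < c (\<pi> (Suc i)) \<or> i \<in> A_descents l E \<pi> \<and> c (\<pi> i) = c (\<pi> (Suc i))"
    if i: "i \<in> {1..<l}" for i
  proof -
    have ii: "i \<in> {1..l}" "Suc i \<in> {1..l}" using i by auto
    have pp: "\<pi> i \<in> {1..l}" "\<pi> (Suc i) \<in> {1..l}" using ii in' by auto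
    have less: "c (\<pi> i) < c (\<pi> (Suc i)) \<or> c (\<pi> i) = c (\<pi> (Suc i)) \<and> \<pi> (Suc i) < \<pi> i"
      using mono[OF ii] keyiff[OF pp] by auto
    show ?thesis
    proof (cases "c (\<pi> i) < c (\<pi> (Suc i))")
      case False
      hence eq: "c (\<pi> i) = c (\<pi> (Suc i))" "\<pi> (Suc i) < \<pi> i" using less by auto
      have "{\<pi> i, \<pi> (Suc i)} \<notin> E"
      proof (rule consec)
        fix w assume w: "\<pi> (Suc i) < w" "w < \<pi> i"
        show "c w \<noteq> c (\<pi> i)"
        proof
          \<comment> \<open>Such a vertex would have its key between those at positions
            \<open>i\<close> and \<open>Suc i\<close>, hence an intermediate position.\<close>
          assume cw: "c w = c (\<pi> i)"
          have wl: "w \<in> {1..l}" using w pp by auto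
          obtain j where j: "w = \<pi> j" using permutes_surj[OF \<pi>(1)] by blast
          have jl: "j \<in> {1..l}" using in' wl j by blast
          have "key (\<pi> i) < key (\<pi> j)" "key (\<pi> j) < key (\<pi> (Suc i))"
            using keyiff pp wl j w cw eq by auto
          hence "i < j" "j < Suc i" using mono ii jl by auto
          thus False by simp
        qed
      qed (use pp eq in auto)
      thus ?thesis using eq A_descents_less[OF i] by simp
    qed simp
  qed
  hence "c \<in> colorings_along l E \<pi> q" using c by (simp add: colorings_along_def)
  thus ?thesis using \<pi>(1) by blast
qed

section \<open>The upper bound \<open>N(q)\<close> for the number of proper colourings\<close>

definition colorings_bound :: "nat \<Rightarrow> nat set set \<Rightarrow> nat \<Rightarrow> (nat \<Rightarrow> nat) set" where
  "colorings_bound l E q = (\<Union>\<pi>\<in>{\<pi>. \<pi> permutes {1..l}}. colorings_along l E \<pi> q)"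

lemma finite_colorings_bound [simp]: "finite (colorings_bound l E q)"
  unfolding colorings_bound_def by (auto intro!: finite_permutations)

lemma card_colorings_bound:
  "card (colorings_bound l E q)
   = (\<Sum>\<pi> | \<pi> permutes {1..l}. (q + card (A_descents l E \<pi> - {l})) choose l)"
proof -
  have "card (colorings_bound l E q)
      = (\<Sum>\<pi> | \<pi> permutes {1..l}. card (colorings_along l E \<pi> q))"
    unfolding colorings_bound_def
    using colorings_along_disjoint[of _ l E _ q]
    by (intro card_UN_disjoint) (auto intro!: finite_permutations)
  also have "\<dots> = (\<Sum>\<pi> | \<pi> permutes {1..l}. (q + card (A_descents l E \<pi> - {l})) choose l)"
    by (rule sum.cong) (auto simp: card_colorings_along)
  finally show ?thesis .
qed

lemma proper_colorings_subset_bound: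
  "proper_colorings {1..l} E q \<subseteq> colorings_bound l E q"
proof
  fix c assume c: "c \<in> proper_colorings {1..l} E q"
  have "\<exists>\<pi>. \<pi> permutes {1..l} \<and> c \<in> colorings_along l E \<pi> q"
    using c by (intro ex_colorings_along) (auto simp: proper_colorings_def)
  thus "c \<in> colorings_bound l E q" by (auto simp: colorings_bound_def)
qed

text \<open>Consecutive vertices in a run of equal colours form descending non-edges; transitivity
  of the non-edges extends this to all pairs of the run.\<close>

lemma colorings_along_proper:
  assumes uf: "umbrella_free l E" and \<pi>: "\<pi> permutes {1..l}" and c: "c \<in> colorings_along l E \<pi> q"
    and "1 \<le> i" "i < j" "j \<le> l" "c (\<pi> i) = c (\<pi> j)"
  shows "\<pi> j < \<pi> i \<and> {\<pi> j, \<pi> i} \<notin> E"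
proof -
  have consec: "c (\<pi> m) < c (\<pi> (Suc m)) \<or>
      c (\<pi> m) = c (\<pi> (Suc m)) \<and> \<pi> (Suc m) < \<pi> m \<and> {\<pi> (Suc m), \<pi> m} \<notin> E"
    if m: "m \<in> {1..<l}" for m
  proof -
    have "c (\<pi> m) < c (\<pi> (Suc m)) \<or> m \<in> A_descents l E \<pi> \<and> c (\<pi> m) = c (\<pi> (Suc m))"
      using c m unfolding colorings_along_def by blast
    thus ?thesis using A_descents_less[OF m, of E \<pi>] by (auto simp: insert_commute)
  qed
  have p: "\<pi> m \<in> {1..l}" if "m \<in> {1..l}" for m using permutes_in_image[OF \<pi>] that by blast
  have "Suc i \<le> j" using assms by simp
  \<comment> \<open>The strict alternative makes the claim true for every \<open>j\<close>, as the
    induction needs.\<close>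
  hence "c (\<pi> i) < c (\<pi> j) \<or> c (\<pi> i) = c (\<pi> j) \<and> \<pi> j < \<pi> i \<and> {\<pi> j, \<pi> i} \<notin> E"
    using \<open>j \<le> l\<close>
  proof (induction j rule: dec_induct)
    case base
    thus ?case using consec[of i] assms by auto
  next
    case (step m)
    hence m: "m \<in> {1..<l}" using \<open>1 \<le> i\<close> by auto
    have IH: "c (\<pi> i) < c (\<pi> m) \<or> c (\<pi> i) = c (\<pi> m) \<and> \<pi> m < \<pi> i \<and> {\<pi> m, \<pi> i} \<notin> E"
      using step by auto
    have "\<pi> (Suc m) \<in> {1..l}" "\<pi> i \<in> {1..l}" using p m \<open>1 \<le> i\<close> \<open>Suc i \<le> m\<close> by auto
    thus ?case
      using IH consec[OF m] umbrella_freeD[OF uf, of "\<pi> (Suc m)" "\<pi> m" "\<pi> i"] by auto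
  qed
  thus ?thesis using assms by auto
qed

lemma proper_colorings_eq_bound:
  assumes uf: "umbrella_free l E" and E: "simple_graph {1..l} E"
  shows "proper_colorings {1..l} E q = colorings_bound l E q"
proof (rule antisym[OF proper_colorings_subset_bound], rule subsetI)
  fix c assume "c \<in> colorings_bound l E q"
  then obtain \<pi> where \<pi>: "\<pi> permutes {1..l}" and c: "c \<in> colorings_along l E \<pi> q"
    by (auto simp: colorings_bound_def)
  have "c u \<noteq> c v" if uv: "u \<in> {1..l}" "v \<in> {1..l}" "{u, v} \<in> E" for u v
  proof
    assume eq: "c u = c v"
    have "u \<noteq> v" using E uv by (auto simp: simple_graph_def)
    obtain i j where ij: "u = \<pi> i" "v = \<pi> j" using permutes_surj[OF \<pi>] by blast
    have "i \<in> {1..l}" "j \<in> {1..l}" "i \<noteq> j"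
      using uv ij permutes_in_image[OF \<pi>] \<open>u \<noteq> v\<close> by auto
    thus False
      using colorings_along_proper[OF uf \<pi> c, of i j] colorings_along_proper[OF uf \<pi> c, of j i]
        eq ij uv by (cases "i < j") (auto simp: insert_commute)
  qed
  thus "c \<in> proper_colorings {1..l} E q"
    using c by (auto simp: proper_colorings_def colorings_along_def)
qed

text \<open>Giving one colour to the three vertices of an umbrella yields a colouring that is not
  proper but that the bound counts: only neighbours in the colour class are tested, and these are
  the two non-edges.\<close>

lemma umbrella_free_if_card_eq:
  assumes E: "simple_graph {1..l} E"
    and eq: "card (proper_colorings {1..l} E l) = card (colorings_bound l E l)"
  shows "umbrella_free l E"
proof (rule ccontr)
  assume "\<not> umbrella_free l E"
  then obtain i k j where ikj: "1 \<le> i" "i < k" "k < j" "j \<le> l" "{i, j} \<in> E"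
    "{i, k} \<notin> E" "{k, j} \<notin> E"
    unfolding umbrella_free_def by blast
  \<comment> \<open>Every vertex has its own colour \<open>v - 1\<close>, except that
    \<open>k\<close> and \<open>j\<close> join \<open>i\<close>; so \<open>l\<close> colours
    suffice.\<close>
  define c where "c = (\<lambda>v\<in>{1..l}. if v \<in> {k, j} then i - 1 else v - 1)"
  have "\<exists>\<pi>. \<pi> permutes {1..l} \<and> c \<in> colorings_along l E \<pi> l"
  proof (rule ex_colorings_along)
    show "c \<in> {1..l} \<rightarrow>\<^sub>E {..<l}" using ikj by (auto simp: c_def)
    fix u v assume *: "u \<in> {1..l}" "v < u" "1 \<le> v" "c u = c v"
      "\<And>w. v < w \<Longrightarrow> w < u \<Longrightarrow> c w \<noteq> c u"
    hence "u \<in> {i, k, j}" "v \<in> {i, k, j}" using ikj(1) by (auto simp: c_def split: if_splits)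
    moreover have "\<not> (v = i \<and> u = j)" using *(5)[of k] ikj by (auto simp: c_def)
    ultimately show "{u, v} \<notin> E" using ikj *(2) by (auto simp: insert_commute)
  qed
  hence "c \<in> colorings_bound l E l" by (auto simp: colorings_bound_def)
  moreover have "c \<notin> proper_colorings {1..l} E l"
  proof
    assume "c \<in> proper_colorings {1..l} E l"
    hence "c i \<noteq> c j" using ikj by (simp add: proper_colorings_def)
    thus False using ikj by (simp add: c_def)
  qed
  ultimately have "proper_colorings {1..l} E l \<subset> colorings_bound l E l"
    using proper_colorings_subset_bound[of l E l] by blast
  from psubset_card_mono[OF _ this] eq show False by simp
qed

section \<open>Rotating permutations\<close>

definition cyc :: "nat \<Rightarrow> nat \<Rightarrow> nat" where
  "cyc l i = (if i \<in> {1..l} then if i = l then 1 else Suc i else i)"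

lemma cyc_permutes: "cyc l permutes {1..l}"
proof (rule bij_imp_permutes)
  show "bij_betw (cyc l) {1..l} {1..l}"
    by (rule bij_betw_byWitness[where f' = "\<lambda>i. if i = 1 then l else i - 1"])
      (auto simp: cyc_def)
qed (auto simp: cyc_def)

lemma A_descents_cyc:
  "A_descents l E \<pi> = {i \<in> {1..l}. \<pi> i > \<pi> (cyc l i) \<and> {\<pi> i, \<pi> (cyc l i)} \<notin> E}"
  by (auto simp: A_descents_def cyc_def Let_def)

lemma A_descents_comp_cyc: "cyc l i \<in> A_descents l E \<pi> \<longleftrightarrow> i \<in> A_descents l E (\<pi> \<circ> cyc l)"
  using permutes_in_image[OF cyc_permutes, of l i] by (auto simp: A_descents_cyc)

lemma card_A_descents_comp_cyc:
  "card (A_descents l E \<pi> - {cyc l j}) = card (A_descents l E (\<pi> \<circ> cyc l) - {j})"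
proof -
  have inj: "inj (cyc l)" using permutes_inj[OF cyc_permutes] .
  have "A_descents l E \<pi> - {cyc l j} = cyc l ` (A_descents l E (\<pi> \<circ> cyc l) - {j})"
  proof (intro equalityI subsetI)
    fix i assume "i \<in> A_descents l E \<pi> - {cyc l j}"
    moreover obtain i' where "i = cyc l i'" using permutes_surj[OF cyc_permutes] by blast
    ultimately show "i \<in> cyc l ` (A_descents l E (\<pi> \<circ> cyc l) - {j})"
      using A_descents_comp_cyc by blast
  next
    fix i assume "i \<in> cyc l ` (A_descents l E (\<pi> \<circ> cyc l) - {j})"
    thus "i \<in> A_descents l E \<pi> - {cyc l j}"
      using A_descents_comp_cyc injD[OF inj] by blast
  qed
  thus ?thesis using inj by (simp add: card_image inj_on_def)
qed

text \<open>Replacing \<pi> by \<open>\<pi> \<circ> cyc l\<close> permutes the summands and shifts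
  the deleted position by one.\<close>

lemma sum_A_descents_rotate:
  assumes "j \<in> {1..l}"
  shows "(\<Sum>\<pi> | \<pi> permutes {1..l}. h (card (A_descents l E \<pi> - {j})))
       = (\<Sum>\<pi> | \<pi> permutes {1..l}. h (card (A_descents l E \<pi> - {l})))"
proof -
  let ?S = "\<lambda>j. \<Sum>\<pi> | \<pi> permutes {1..l}. h (card (A_descents l E \<pi> - {j}))"
  have "?S (cyc l j) = ?S j" for j
  proof -
    have "?S (cyc l j) = (\<Sum>\<pi> | \<pi> permutes {1..l}. h (card (A_descents l E (\<pi> \<circ> cyc l) - {j})))"
      by (simp add: card_A_descents_comp_cyc)
    also have "\<dots> = ?S j"
      by (rule sum_permutations_compose_right[OF cyc_permutes, symmetric])
    finally show ?thesis .
  qed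
  hence rot: "?S (Suc j) = ?S j" if "1 \<le> j" "j < l" for j
    using that by (metis atLeastAtMost_iff cyc_def less_imp_le_nat nat_neq_iff)
  have "j \<le> l" using assms by simp
  thus ?thesis
    using assms
  proof (induction j rule: inc_induct)
    case (step n)
    thus ?case using rot[of n] by auto
  qed simp
qed

text \<open>The position that carries the smallest value is never a descent.\<close>

lemma card_A_descents_less:
  assumes "l \<ge> 1"
  shows "card (A_descents l E \<pi>) < l"
proof -
  obtain i where i: "i \<in> {1..l}" "\<And>j. j \<in> {1..l} \<Longrightarrow> \<pi> i \<le> \<pi> j"
    using assms ex_min_if_finite[of "\<pi> ` {1..l}"] by (auto simp: not_less)
  have "cyc l i \<in> {1..l}" using i permutes_in_image[OF cyc_permutes] by blast
  hence "i \<notin> A_descents l E \<pi>" using i by (auto simp: A_descents_cyc not_less)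
  hence "A_descents l E \<pi> \<subset> {1..l}" using i A_descents_subset by blast
  from psubset_card_mono[OF _ this] show ?thesis by simp
qed

text \<open>This averages over the deleted position for a permutation with \<open>d\<close>
  descents: in \<open>d\<close> of the \<open>l\<close> cases the deletion removes a descent. The
  proof rests on the absorption identity for binomials.\<close>

lemma binomial_weighted:
  assumes "d < l"
  shows "(l - d) * ((q + d) choose l) + d * ((q + (d - 1)) choose l) = q * ((q + d - 1) choose (l - 1))"
proof (cases "q + d")
  case 0
  thus ?thesis using assms by simp
next
  case (Suc n)
  obtain l' where l': "l = Suc l'" using assms by (cases l) auto
  have eq: "d * ((q + (d - 1)) choose l) = d * (n choose l)"
    using Suc by (cases d) auto
  have n: "Suc l' * (n choose Suc l') + l' * (n choose l') = n * (n choose l')"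
  proof -
    have "Suc l' * (n choose Suc l') = (n - l') * (n choose l')"
      by (metis binomial_absorb_comp binomial_absorption mult.commute)
    thus ?thesis by (cases "l' \<le> n") (auto simp: add_mult_distrib[symmetric] binomial_eq_0)
  qed
  have "int ((l - d) * (Suc n choose l) + d * (n choose l)) = int (q * (n choose l'))"
  proof -
    have dl: "int (l - d) = int l - int d" using assms by simp
    have "int (q * (n choose l')) = (int (Suc n) - int d) * int (n choose l')"
      using Suc by (metis add_diff_cancel_right' of_nat_add of_nat_mult)
    also have "\<dots> = int (n * (n choose l')) + (1 - int d) * int (n choose l')"
      by (simp add: algebra_simps)
    also have "\<dots> = int (Suc l' * (n choose Suc l') + l' * (n choose l')) + (1 - int d) * int (n choose l')"
      by (simp only: n)
    also have "\<dots> = int ((l - d) * (Suc n choose l) + d * (n choose l))"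
      unfolding of_nat_add of_nat_mult dl by (simp add: l' algebra_simps)
    finally show ?thesis ..
  qed
  thus ?thesis unfolding eq using Suc l' by (simp only: of_nat_eq_iff) simp
qed

text \<open>The factor \<open>l\<close> becomes a sum over the deleted position \<open>j\<close>,
  which by rotation may replace \<open>l\<close>. After exchanging the sums,
  \<open>binomial_weighted\<close> evaluates the inner one for each \<pi>.\<close>

lemma card_colorings_bound_mult:
  assumes "l \<ge> 1"
  shows "l * card (colorings_bound l E q)
    = q * (\<Sum>\<pi> | \<pi> permutes {1..l}. (q + card (A_descents l E \<pi>) - 1) choose (l - 1))"
proof -
  let ?P = "{\<pi>. \<pi> permutes {1..l}}" and ?D = "\<lambda>\<pi>. A_descents l E \<pi>"
  have "l * card (colorings_bound l E q)
      = (\<Sum>j\<in>{1..l}. \<Sum>\<pi>\<in>?P. (q + card (?D \<pi> - {l})) choose l)"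
    by (simp add: card_colorings_bound)
  also have "\<dots> = (\<Sum>j\<in>{1..l}. \<Sum>\<pi>\<in>?P. (q + card (?D \<pi> - {j})) choose l)"
    by (rule sum.cong[OF refl], rule sum_A_descents_rotate[symmetric])
  also have "\<dots> = (\<Sum>\<pi>\<in>?P. \<Sum>j\<in>{1..l}. (q + card (?D \<pi> - {j})) choose l)"
    by (rule sum.swap)
  also have "\<dots> = (\<Sum>\<pi>\<in>?P. q * ((q + card (?D \<pi>) - 1) choose (l - 1)))"
  proof (rule sum.cong[OF refl])
    fix \<pi>
    have sub: "?D \<pi> \<subseteq> {1..l}" by (rule A_descents_subset)
    have fin: "finite (?D \<pi>)" using sub finite_subset by blast
    have "(\<Sum>j\<in>{1..l}. (q + card (?D \<pi> - {j})) choose l)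
        = (\<Sum>j\<in>{1..l} - ?D \<pi>. (q + card (?D \<pi> - {j})) choose l)
          + (\<Sum>j\<in>?D \<pi>. (q + card (?D \<pi> - {j})) choose l)"
      by (rule sum.subset_diff[OF sub]) simp
    also have "(\<Sum>j\<in>{1..l} - ?D \<pi>. (q + card (?D \<pi> - {j})) choose l)
        = (\<Sum>j\<in>{1..l} - ?D \<pi>. (q + card (?D \<pi>)) choose l)"
      by (rule sum.cong) auto
    also have "\<dots> = (l - card (?D \<pi>)) * ((q + card (?D \<pi>)) choose l)"
      using card_Diff_subset[OF fin sub] by simp
    also have "(\<Sum>j\<in>?D \<pi>. (q + card (?D \<pi> - {j})) choose l)
        = (\<Sum>j\<in>?D \<pi>. (q + (card (?D \<pi>) - 1)) choose l)"
      using fin by (intro sum.cong) auto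
    also have "\<dots> = card (?D \<pi>) * ((q + (card (?D \<pi>) - 1)) choose l)" by simp
    finally show "(\<Sum>j\<in>{1..l}. (q + card (?D \<pi> - {j})) choose l)
        = q * ((q + card (?D \<pi>) - 1) choose (l - 1))"
      using binomial_weighted[OF card_A_descents_less[OF assms]] by simp
  qed
  finally show ?thesis by (simp add: sum_distrib_left)
qed

text \<open>Permutations with \<open>d\<close> descents are grouped by \<open>k = l - d\<close>,
  which is positive since \<open>d < l\<close>; the factor \<open>l\<close> cancels the division in
  \<open>f_coeff\<close>.\<close>

lemma card_colorings_bound_f_coeff:
  assumes "l \<ge> 1"
  shows "real (card (colorings_bound l E q))
    = real q * (\<Sum>k = 1..l. f_coeff l E k * real ((q + l - 1 - k) choose (l - 1)))"
proof -
  let ?P = "{\<pi>. \<pi> permutes {1..l}}" and ?d = "\<lambda>\<pi>. card (A_descents l E \<pi>)"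
  have fin: "finite ?P" by (rule finite_permutations) simp
  have dl: "?d \<pi> < l" for \<pi> by (rule card_A_descents_less[OF assms])
  have "(\<Sum>\<pi>\<in>?P. real ((q + ?d \<pi> - 1) choose (l - 1)))
      = (\<Sum>k = 1..l. \<Sum>\<pi>\<in>{\<pi> \<in> ?P. l - ?d \<pi> = k}. real ((q + ?d \<pi> - 1) choose (l - 1)))"
    using dl by (intro sum.group[symmetric]) (use fin in \<open>auto simp: Suc_le_eq\<close>)
  also have "\<dots> = (\<Sum>k = 1..l. real l * (f_coeff l E k * real ((q + l - 1 - k) choose (l - 1))))"
  proof (rule sum.cong[OF refl])
    fix k assume k: "k \<in> {1..l}"
    have set: "{\<pi> \<in> ?P. l - ?d \<pi> = k} = {\<pi>. \<pi> permutes {1..l} \<and> ?d \<pi> + k = l}"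
      using dl k by (auto simp: less_imp_le)
    have "(\<Sum>\<pi>\<in>{\<pi> \<in> ?P. l - ?d \<pi> = k}. real ((q + ?d \<pi> - 1) choose (l - 1)))
        = (\<Sum>\<pi>\<in>{\<pi> \<in> ?P. l - ?d \<pi> = k}. real ((q + l - 1 - k) choose (l - 1)))"
    proof (rule sum.cong[OF refl])
      fix \<pi> assume "\<pi> \<in> {\<pi> \<in> ?P. l - ?d \<pi> = k}"
      hence "q + ?d \<pi> - 1 = q + l - 1 - k" using dl[of \<pi>] by auto
      thus "real ((q + ?d \<pi> - 1) choose (l - 1)) = real ((q + l - 1 - k) choose (l - 1))" by simp
    qed
    also have "\<dots> = real l * (f_coeff l E k * real ((q + l - 1 - k) choose (l - 1)))"
      unfolding sum_constant set f_coeff_def using assms by simp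
    finally show "(\<Sum>\<pi>\<in>{\<pi> \<in> ?P. l - ?d \<pi> = k}. real ((q + ?d \<pi> - 1) choose (l - 1)))
        = real l * (f_coeff l E k * real ((q + l - 1 - k) choose (l - 1)))" .
  qed
  also have "\<dots> = real l * (\<Sum>k = 1..l. f_coeff l E k * real ((q + l - 1 - k) choose (l - 1)))"
    by (simp add: sum_distrib_left)
  finally have "real l * real (card (colorings_bound l E q))
      = real l * (real q * (\<Sum>k = 1..l. f_coeff l E k * real ((q + l - 1 - k) choose (l - 1))))"
    using arg_cong[OF card_colorings_bound_mult[OF assms, of E q], of real] by simp
  thus ?thesis using assms by simp
qed

section \<open>Generating functions\<close>

abbreviation chromatic_count :: "nat \<Rightarrow> nat set set \<Rightarrow> nat \<Rightarrow> nat" where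
  "chromatic_count l E q \<equiv> card (proper_colorings {1..l} E q)"

abbreviation bound_count :: "nat \<Rightarrow> nat set set \<Rightarrow> nat \<Rightarrow> nat" where
  "bound_count l E q \<equiv> card (colorings_bound l E q)"

definition bound_series :: "nat \<Rightarrow> nat set set \<Rightarrow> real fps" where
  "bound_series l E = Abs_fps (\<lambda>q. if q = 0 then 0 else real (bound_count l E q) / real q)"

lemma f_coeff_0:
  assumes "l \<ge> 1"
  shows "f_coeff l E 0 = 0"
proof -
  have "card (A_descents l E \<pi>) \<noteq> l" for \<pi>
    using card_A_descents_less[OF assms, of E \<pi>] by simp
  thus ?thesis by (simp add: f_coeff_def)
qed

lemma bound_count_0: "l \<ge> 1 \<Longrightarrow> bound_count l E 0 = 0"
  using card_colorings_bound_mult[of l E 0] by simp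

lemma chromatic_count_0: "l \<ge> 1 \<Longrightarrow> chromatic_count l E 0 = 0"
  using card_mono[OF finite_colorings_bound proper_colorings_subset_bound, of l E 0] bound_count_0 by simp

lemma one_minus_fps_X_power_neq_0: "(1 - fps_X :: real fps) ^ n \<noteq> 0"
proof -
  have "fps_nth ((1 - fps_X :: real fps) ^ n) 0 \<noteq> 0" by (simp add: fps_nth_power_0)
  thus ?thesis by auto
qed

text \<open>The coefficients of \<open>(1 - t)^(-l)\<close> are the binomials
  \<open>(l + k - 1) choose (l - 1)\<close>; convolving them with \<open>f_coeff\<close> gives the
  formula for \<open>N(q) / q\<close>. This holds for every graph.\<close>

lemma fps_power_mult_bound_series:
  assumes "l \<ge> 1"
  shows "F_series l E = (1 - fps_X) ^ l * bound_series l E"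
proof -
  have inv: "inverse ((1 - fps_X :: real fps) ^ l) = Abs_fps (\<lambda>k. real ((l + k - 1) choose (l - 1)))"
  proof -
    have "(l + k - 1) choose k = (l + k - 1) choose (l - 1)" for k
      using assms by (subst binomial_symmetric) auto
    thus ?thesis
      using one_minus_const_fps_X_neg_power'[of l "1 :: real"] assms by simp
  qed
  have "bound_series l E = F_series l E * inverse ((1 - fps_X) ^ l)"
  proof (rule fps_ext)
    fix q
    have "fps_nth (F_series l E * inverse ((1 - fps_X) ^ l)) q =
        (\<Sum>k = 1..l. f_coeff l E k * (if q < k then 0 else real ((l + (q - k) - 1) choose (l - 1))))"
      unfolding F_series_def inv sum_distrib_right fps_sum_nth mult.assoc
      by (simp add: fps_X_power_mult_nth cong: if_cong)
    also have "\<dots> = fps_nth (bound_series l E) q"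
    \<comment> \<open>For \<open>l = 1\<close> and \<open>q = 0\<close> the truncated binomial is 1
      and not 0, so this case is separate. For \<open>0 < q < k\<close> it does vanish.\<close>
    proof (cases "q = 0")
      case False
      have "(\<Sum>k = 1..l. f_coeff l E k * (if q < k then 0 else real ((l + (q - k) - 1) choose (l - 1))))
          = (\<Sum>k = 1..l. f_coeff l E k * real ((q + l - 1 - k) choose (l - 1)))"
      proof (rule sum.cong[OF refl])
        fix k assume "k \<in> {1..l}"
        thus "f_coeff l E k * (if q < k then 0 else real ((l + (q - k) - 1) choose (l - 1)))
            = f_coeff l E k * real ((q + l - 1 - k) choose (l - 1))"
          using False assms by (cases "q < k") (auto simp: binomial_eq_0 add.commute)
      qed
      thus ?thesis using False card_colorings_bound_f_coeff[OF assms, of E q]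
        by (simp add: bound_series_def)
    qed (auto simp: bound_series_def intro!: sum.neutral)
    finally show "fps_nth (bound_series l E) q = fps_nth (F_series l E * inverse ((1 - fps_X) ^ l)) q" ..
  qed
  hence "(1 - fps_X) ^ l * bound_series l E
      = F_series l E * (inverse ((1 - fps_X) ^ l) * (1 - fps_X) ^ l)"
    by (simp only: mult_ac)
  also have "inverse ((1 - fps_X) ^ l) * (1 - fps_X) ^ l = (1 :: real fps)"
    by (rule inverse_mult_eq_1) (simp add: fps_nth_power_0)
  finally show ?thesis by simp
qed

lemma Y_series_eq_F_series_iff:
  assumes "l \<ge> 1"
  shows "F_series l E = Y_series {1..l} E \<longleftrightarrow> (\<forall>q. chromatic_count l E q = bound_count l E q)"
proof -
  have "F_series l E = Y_series {1..l} E \<longleftrightarrow>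
      bound_series l E = Abs_fps (\<lambda>q. if q = 0 then 0 else real (chromatic_count l E q) / real q)"
    unfolding fps_power_mult_bound_series[OF assms] Y_series_def
    using one_minus_fps_X_power_neq_0[of l] by (simp add: poly_chromatic_poly cong: if_cong)
  also have "\<dots> \<longleftrightarrow> (\<forall>q. (if q = 0 then 0 else real (bound_count l E q) / real q)
      = (if q = 0 then 0 else real (chromatic_count l E q) / real q))"
    by (simp only: bound_series_def fps_eq_iff fps_nth_Abs_fps)
  also have "\<dots> \<longleftrightarrow> (\<forall>q. chromatic_count l E q = bound_count l E q)"
    using bound_count_0[OF assms, of E] chromatic_count_0[OF assms, of E]
    by (intro all_cong1) auto
  finally show ?thesis .
qed

text \<open>Write \<open>F = (1 - t)^l * Z\<close>. In \<open>(1 - t) * F'\<close> the power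
  contributes \<open>- l * F\<close>, which the added \<open>t * l * F\<close> cancels after
  multiplication by \<open>t\<close>. What remains involves \<open>t * Z'\<close>.\<close>

lemma F_series_deriv:
  assumes "l \<ge> 1"
  shows "fps_X * (1 - fps_X) * fps_deriv (F_series l E) + fps_X * of_nat l * F_series l E
    = (1 - fps_X) ^ (l + 1) * Abs_fps (\<lambda>q. real (bound_count l E q))"
proof -
  let ?Z = "bound_series l E" and ?T = "1 - fps_X :: real fps"
  \<comment> \<open>The operator \<open>t d/dt\<close> undoes the division by \<open>q\<close>; at
    \<open>q = 0\<close> both sides vanish.\<close>
  have XZ: "fps_X * fps_deriv ?Z = Abs_fps (\<lambda>q. real (bound_count l E q))"
    using bound_count_0[OF assms, of E] by (auto simp: fps_eq_iff bound_series_def)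
  have "?T * ?T ^ (l - 1) = ?T ^ l" using assms by (cases l) auto
  hence T: "?T * (?T ^ (l - 1) * x) = ?T ^ l * x" for x by (simp only: mult.assoc[symmetric])
  have D: "fps_deriv (F_series l E) = ?T ^ l * fps_deriv ?Z - of_nat l * ?T ^ (l - 1) * ?Z"
    unfolding fps_power_mult_bound_series[OF assms] by (simp add: fps_deriv_power')
  have "?T * fps_deriv (F_series l E) = ?T ^ (l + 1) * fps_deriv ?Z - of_nat l * (?T * (?T ^ (l - 1) * ?Z))"
    unfolding D by (simp add: algebra_simps)
  also have "\<dots> = ?T ^ (l + 1) * fps_deriv ?Z - of_nat l * F_series l E"
    by (simp only: T fps_power_mult_bound_series[OF assms])
  finally have M: "?T * fps_deriv (F_series l E) = ?T ^ (l + 1) * fps_deriv ?Z - of_nat l * F_series l E" .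
  have "fps_X * (?T * fps_deriv (F_series l E)) + fps_X * of_nat l * F_series l E
      = ?T ^ (l + 1) * (fps_X * fps_deriv ?Z)"
    unfolding M by (simp add: algebra_simps)
  thus ?thesis by (simp only: XZ mult.assoc)
qed

lemma W_series_eq: "W_series {1..l} E = (1 - fps_X) ^ (l + 1) * Abs_fps (\<lambda>q. real (chromatic_count l E q))"
  by (simp add: W_series_def poly_chromatic_poly)

lemma W_series_eq_iff:
  assumes "l \<ge> 1"
  shows "W_series {1..l} E = fps_X * (1 - fps_X) * fps_deriv (F_series l E) + fps_X * of_nat l * F_series l E
    \<longleftrightarrow> (\<forall>q. chromatic_count l E q = bound_count l E q)"
  unfolding F_series_deriv[OF assms] W_series_eq
    mult_left_cancel[OF one_minus_fps_X_power_neq_0[of "l + 1"]]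
  by (simp add: fps_eq_iff)

lemma nth_F_series: "fps_nth (F_series l E) k = (if k \<in> {1..l} then f_coeff l E k else 0)"
proof -
  have "fps_nth (F_series l E) k = (\<Sum>i = 1..l. if i = k then f_coeff l E k else 0)"
    unfolding F_series_def fps_sum_nth by (rule sum.cong) auto
  thus ?thesis by simp
qed

lemma nth_F_series_deriv:
  assumes "k \<in> {1..l}"
  shows "fps_nth (fps_X * (1 - fps_X) * fps_deriv (F_series l E) + fps_X * of_nat l * F_series l E) k
    = of_nat k * f_coeff l E k + of_nat (l - k + 1) * f_coeff l E (k - 1)"
proof -
  have f: "fps_nth (F_series l E) k = f_coeff l E k" "fps_nth (F_series l E) (k - 1) = f_coeff l E (k - 1)"
    using assms f_coeff_0[of l E] by (auto simp: nth_F_series)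
  have eq: "fps_X * (1 - fps_X) * fps_deriv (F_series l E) + fps_X * of_nat l * F_series l E
      = fps_X * fps_deriv (F_series l E) + fps_X * (fps_const (real l) * F_series l E - fps_X * fps_deriv (F_series l E))"
    by (simp add: algebra_simps fps_of_nat)
  have "fps_nth (fps_X * (1 - fps_X) * fps_deriv (F_series l E) + fps_X * of_nat l * F_series l E) k
      = real k * f_coeff l E k + (real l - real (k - 1)) * f_coeff l E (k - 1)"
  proof -
    obtain k' where "k = Suc k'" using assms by (cases k) auto
    thus ?thesis unfolding eq using assms f by (cases k') (auto simp: algebra_simps)
  qed
  also have "real l - real (k - 1) = real (l - k + 1)" using assms by auto
  finally show ?thesis .
qed

text \<open>Dividing by a unit is triangular: coefficients of the quotient up to \<open>n\<close>
  depend only on those of the product up to \<open>n\<close>.\<close>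

lemma nth_eq_if_unit_mult_nth_eq:
  fixes f g h :: "'a::field fps"
  assumes "\<And>k. k \<le> n \<Longrightarrow> fps_nth (h * f) k = fps_nth (h * g) k" and "fps_nth h 0 \<noteq> 0"
  shows "fps_nth f n = fps_nth g n"
proof -
  have inv: "inverse h * (h * x) = x" for x
    using inverse_mult_eq_1[OF assms(2)] by (simp add: mult.assoc[symmetric])
  have "fps_nth (inverse h * (h * f)) n = fps_nth (inverse h * (h * g)) n"
    unfolding fps_mult_nth[of "inverse h"] using assms(1) by (intro sum.cong) auto
  thus ?thesis unfolding inv .
qed

text \<open>The conditions on \<open>w_coeff\<close> reach only up to \<open>k = l\<close>. They
  determine the counts up to \<open>q = l\<close>, which is enough to detect an umbrella.\<close>

lemma w_coeff_imp_count_eq: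
  assumes "l \<ge> 1"
    and w: "\<forall>k\<in>{1..l}. w_coeff {1..l} E k = of_nat k * f_coeff l E k + of_nat (l - k + 1) * f_coeff l E (k - 1)"
  shows "chromatic_count l E l = bound_count l E l"
proof -
  have "fps_nth (Abs_fps (\<lambda>q. real (chromatic_count l E q))) l = fps_nth (Abs_fps (\<lambda>q. real (bound_count l E q))) l"
  proof (rule nth_eq_if_unit_mult_nth_eq)
    show "fps_nth ((1 - fps_X :: real fps) ^ (l + 1)) 0 \<noteq> 0" by (simp add: fps_nth_power_0)
    fix k assume "k \<le> l"
    show "fps_nth ((1 - fps_X) ^ (l + 1) * Abs_fps (\<lambda>q. real (chromatic_count l E q))) k
        = fps_nth ((1 - fps_X) ^ (l + 1) * Abs_fps (\<lambda>q. real (bound_count l E q))) k"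
    proof (cases "k = 0")
      case True
      \<comment> \<open>The hypothesis starts at \<open>k = 1\<close>; the constant terms agree
        since both counts vanish at 0.\<close>
      thus ?thesis using bound_count_0[OF assms(1), of E] chromatic_count_0[OF assms(1), of E]
        by (simp add: fps_mult_nth)
    next
      case False
      hence "k \<in> {1..l}" using \<open>k \<le> l\<close> by simp
      thus ?thesis
        using w unfolding w_coeff_def W_series_eq F_series_deriv[OF assms(1), symmetric]
        by (subst nth_F_series_deriv) auto
    qed
  qed
  thus ?thesis by simp
qed

lemma W_series_imp_w_coeff:
  assumes "W_series {1..l} E = fps_X * (1 - fps_X) * fps_deriv (F_series l E) + fps_X * of_nat l * F_series l E"
    and "k \<in> {1..l}"
  shows "w_coeff {1..l} E k = of_nat k * f_coeff l E k + of_nat (l - k + 1) * f_coeff l E (k - 1)"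
  unfolding w_coeff_def assms(1) by (rule nth_F_series_deriv[OF assms(2)])

lemma poly_eqI_of_nat:
  fixes p p' :: "'a::{idom, ring_char_0} poly"
  assumes "\<And>n. poly p (of_nat n) = poly p' (of_nat n)"
  shows "p = p'"
proof (rule ccontr)
  assume "p \<noteq> p'"
  hence "finite {x. poly (p - p') x = 0}" by (intro poly_roots_finite) simp
  moreover have "range (of_nat :: nat \<Rightarrow> 'a) \<subseteq> {x. poly (p - p') x = 0}"
    using assms by auto
  ultimately have "finite (range (of_nat :: nat \<Rightarrow> 'a))" by (rule rev_finite_subset)
  thus False using range_inj_infinite[OF inj_of_nat] by blast
qed

text \<open>Both sides are polynomials in \<open>t\<close>, so agreement at the natural numbers
  suffices.\<close>

lemma chromatic_poly_eq_iff:
  assumes "l \<ge> 1"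
  shows "(\<forall>t::real. poly (chromatic_poly {1..l} E) t =
        t * (\<Sum>k = 1..l. f_coeff l E k * ((t + of_nat l - 1 - of_nat k) gchoose (l - 1))))
    \<longleftrightarrow> (\<forall>q. chromatic_count l E q = bound_count l E q)" (is "(\<forall>t. ?L t = ?R t) \<longleftrightarrow> _")
proof -
  \<comment> \<open>At \<open>q = 0\<close> the upper entry of a generalized binomial may be
    negative, but the factor \<open>t\<close> removes it; for \<open>q > 0\<close> the natural
    subtraction does not truncate.\<close>
  have Rq: "?R (real q) = real (bound_count l E q)" for q
  proof (cases "q = 0")
    case False
    have "(real q + real l - 1 - real k) gchoose (l - 1) = real ((q + l - 1 - k) choose (l - 1))"
      if "k \<in> {1..l}" for k
    proof -
      have "real q + real l - 1 - real k = real (q + l - 1 - k)"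
        using that False by (auto simp: of_nat_diff)
      thus ?thesis by (simp add: binomial_gbinomial)
    qed
    thus ?thesis unfolding card_colorings_bound_f_coeff[OF assms]
      by (intro arg_cong2[of _ _ _ _ "(*)"] sum.cong) auto
  qed (simp add: bound_count_0[OF assms])
  define p where "p = [:0, 1:] * (\<Sum>k = 1..l. smult (f_coeff l E k / fact (l - 1))
      (\<Prod>i<l - 1. [:real l - 1 - real k - real i, 1:]))"
  have p: "poly p t = ?R t" for t
    by (simp add: p_def poly_sum poly_prod gbinomial_prod_rev lessThan_atLeast0 algebra_simps)
  have "(\<forall>t. ?L t = ?R t) \<longleftrightarrow> chromatic_poly {1..l} E = p"
    unfolding p[symmetric] by (auto simp: poly_eq_poly_eq_iff[symmetric] fun_eq_iff)
  also have "\<dots> \<longleftrightarrow> (\<forall>q. poly (chromatic_poly {1..l} E) (real q) = poly p (real q))"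
    using poly_eqI_of_nat[of "chromatic_poly {1..l} E" p] by auto
  also have "\<dots> \<longleftrightarrow> (\<forall>q. chromatic_count l E q = bound_count l E q)"
    unfolding p Rq by (simp add: poly_chromatic_poly)
  finally show ?thesis .
qed

section \<open>Invariance under isomorphism\<close>

lemma card_proper_colorings_isomorphic:
  assumes "graph_isomorphic V E V' E'"
  shows "card (proper_colorings V E q) = card (proper_colorings V' E' q)"
proof -
  obtain \<phi> where \<phi>: "bij_betw \<phi> V V'" and edge: "\<And>u v. u \<in> V \<Longrightarrow> v \<in> V \<Longrightarrow> {u, v} \<in> E \<longleftrightarrow> {\<phi> u, \<phi> v} \<in> E'"
    using assms unfolding graph_isomorphic_def by blast
  define \<psi> where "\<psi> = inv_into V \<phi>"
  have \<psi>: "\<psi> v \<in> V" "\<phi> (\<psi> v) = v" if "v \<in> V'" for v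
    using \<phi> that by (auto simp: \<psi>_def bij_betw_def inv_into_into f_inv_into_f)
  have \<phi>': "\<phi> v \<in> V'" "\<psi> (\<phi> v) = v" if "v \<in> V" for v
    using \<phi> that by (auto simp: \<psi>_def bij_betw_def)
  have "bij_betw (\<lambda>c. restrict (c \<circ> \<psi>) V') (proper_colorings V E q) (proper_colorings V' E' q)"
  proof (rule bij_betw_byWitness[where f' = "\<lambda>c. restrict (c \<circ> \<phi>) V"])
    show "\<forall>c\<in>proper_colorings V E q. restrict (restrict (c \<circ> \<psi>) V' \<circ> \<phi>) V = c"
      using \<phi>' by (auto simp: proper_colorings_def fun_eq_iff PiE_iff extensional_def restrict_def)
    show "\<forall>c\<in>proper_colorings V' E' q. restrict (restrict (c \<circ> \<phi>) V \<circ> \<psi>) V' = c"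
      using \<psi> by (auto simp: proper_colorings_def fun_eq_iff PiE_iff extensional_def restrict_def)
    show "(\<lambda>c. restrict (c \<circ> \<psi>) V') ` proper_colorings V E q \<subseteq> proper_colorings V' E' q"
      using \<psi> edge by (auto simp: proper_colorings_def PiE_iff)
    show "(\<lambda>c. restrict (c \<circ> \<phi>) V) ` proper_colorings V' E' q \<subseteq> proper_colorings V E q"
      using \<phi>' edge by (auto simp: proper_colorings_def PiE_iff)
  qed
  thus ?thesis by (rule bij_betw_same_card)
qed

lemma Y_series_isomorphic:
  assumes iso: "graph_isomorphic V E V' E'" and fin: "finite V"
  shows "Y_series V' E' = Y_series V E"
proof -
  obtain \<phi> where \<phi>: "bij_betw \<phi> V V'" using iso unfolding graph_isomorphic_def by blast
  have "finite V'" "card V' = card V"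
    using \<phi> fin bij_betw_finite bij_betw_same_card by metis+
  thus ?thesis
    using fin card_proper_colorings_isomorphic[OF iso]
    by (simp add: Y_series_def poly_chromatic_poly cong: if_cong)
qed

lemma graph_isomorphic_refl: "graph_isomorphic V E V E"
  unfolding graph_isomorphic_def by (rule exI[of _ id]) auto

section \<open>Strong compatibility\<close>

lemma inner_standard_basis:
  assumes "bij_betw \<epsilon> {1..l} Basis" "i \<in> {1..l}" "j \<in> {1..l}"
  shows "\<epsilon> i \<bullet> \<epsilon> j = (if i = j then 1 else 0)"
proof -
  have "\<epsilon> i \<in> Basis" "\<epsilon> j \<in> Basis" "\<epsilon> i = \<epsilon> j \<longleftrightarrow> i = j"
    using assms by (auto simp: bij_betw_def inj_on_eq_iff)
  thus ?thesis by (simp add: inner_Basis)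
qed

lemma root_in_Psi_iff:
  assumes \<epsilon>: "bij_betw \<epsilon> {1..l} Basis" and "1 \<le> i" "i < j" "j \<le> l"
  shows "\<epsilon> i - \<epsilon> j \<in> Psi l \<epsilon> E \<longleftrightarrow> {i, j} \<in> E"
proof
  assume "\<epsilon> i - \<epsilon> j \<in> Psi l \<epsilon> E"
  then obtain a b where ab: "\<epsilon> i - \<epsilon> j = \<epsilon> a - \<epsilon> b" "1 \<le> a" "a < b" "b \<le> l" "{a, b} \<in> E"
    unfolding Psi_def by blast
  have *: "(if i = k then 1 else 0) - (if j = k then 1 else 0 :: real)
      = (if a = k then 1 else 0) - (if b = k then 1 else 0)" if "k \<in> {1..l}" for k
  proof -
    have "(\<epsilon> i - \<epsilon> j) \<bullet> \<epsilon> k = (\<epsilon> a - \<epsilon> b) \<bullet> \<epsilon> k" using ab by simp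
    thus ?thesis using that ab(2-4) assms(2-4) by (simp add: inner_diff_left inner_standard_basis[OF \<epsilon>])
  qed
  have "i = a" using *[of i] assms ab by (auto split: if_splits)
  moreover have "j = b" using *[of j] assms ab by (auto split: if_splits)
  ultimately show "{i, j} \<in> E" using ab by simp
qed (use assms in \<open>auto simp: Psi_def\<close>)

lemma pos_rootI: "1 \<le> i \<Longrightarrow> i < j \<Longrightarrow> j \<le> l \<Longrightarrow> \<epsilon> i - \<epsilon> j \<in> pos_roots l \<epsilon>"
  unfolding pos_roots_def by blast

lemma Psi_subset_pos_roots: "Psi l \<epsilon> E \<subseteq> pos_roots l \<epsilon>"
  by (auto simp: Psi_def pos_roots_def)

lemma strongly_compatible_if_umbrella_free:
  fixes \<epsilon> :: "nat \<Rightarrow> 'a::euclidean_space"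
  assumes \<epsilon>: "bij_betw \<epsilon> {1..l} Basis" and uf: "umbrella_free l E"
  shows "strongly_compatible l \<epsilon> (Psi l \<epsilon> E)"
  unfolding strongly_compatible_def
proof (intro conjI Psi_subset_pos_roots ballI allI impI, elim conjE)
  fix \<alpha> :: 'a and m :: nat and \<beta> :: "nat \<Rightarrow> 'a" and c :: "nat \<Rightarrow> int"
  assume \<alpha>: "\<alpha> \<in> Psi l \<epsilon> E" and \<beta>: "\<forall>k\<in>{1..m}. \<beta> k \<in> pos_roots l \<epsilon> \<and> c k > 0"
    and sum: "\<alpha> = (\<Sum>k = 1..m. of_int (c k) *\<^sub>R \<beta> k)"
  obtain i j where ij: "\<alpha> = \<epsilon> i - \<epsilon> j" "1 \<le> i" "i < j" "j \<le> l" "{i, j} \<in> E"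
    using \<alpha> unfolding Psi_def by blast
  show "\<exists>k\<in>{1..m}. \<beta> k \<in> Psi l \<epsilon> E"
  proof (rule ccontr)
    assume no: "\<not> (\<exists>k\<in>{1..m}. \<beta> k \<in> Psi l \<epsilon> E)"
    text \<open>No root \<open>\<beta> k\<close> leads out of the set \<open>S\<close> of vertices reachable from \<open>i\<close> along increasing
      non-edges, but \<open>\<alpha>\<close> does.\<close>
    define S where "S = {v \<in> {1..l}. v = i \<or> i < v \<and> {i, v} \<notin> E}"
    have fin: "finite S" and Sl: "S \<subseteq> {1..l}" by (auto simp: S_def)
    \<comment> \<open>This linear functional is 1 on a root leaving \<open>S\<close>, -1 on one
      entering it and 0 on all others.\<close>
    define s where "s x = (\<Sum>v\<in>S. x \<bullet> \<epsilon> v)" for x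
    have s_root: "s (\<epsilon> a - \<epsilon> b) = (if a \<in> S then 1 else 0) - (if b \<in> S then 1 else 0)"
      if "1 \<le> a" "a < b" "b \<le> l" for a b
    proof -
      have "s (\<epsilon> a - \<epsilon> b) = (\<Sum>v\<in>S. (if a = v then 1 else 0) - (if b = v then 1 else 0))"
        unfolding s_def using Sl that
        by (intro sum.cong) (auto simp: inner_diff_left inner_standard_basis[OF \<epsilon>] subset_iff)
      thus ?thesis using fin by (simp add: sum_subtractf)
    qed
    have "s (\<beta> k) \<le> 0" if k: "k \<in> {1..m}" for k
    proof -
      obtain a b where ab: "\<beta> k = \<epsilon> a - \<epsilon> b" "1 \<le> a" "a < b" "b \<le> l"
        using \<beta> k unfolding pos_roots_def by blast
      have nE: "{a, b} \<notin> E" using no k ab root_in_Psi_iff[OF \<epsilon> ab(2-4)] by metis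
      \<comment> \<open>Non-edges are transitive, so the endpoints of single ascending non-edges
        from \<open>i\<close>, with \<open>i\<close> itself, are already all reachable
        vertices.\<close>
      have "a \<in> S \<Longrightarrow> b \<in> S"
        using umbrella_freeD[OF uf, of i a b] ab nE ij by (auto simp: S_def)
      thus ?thesis using s_root[OF ab(2-4)] ab(1) by auto
    qed
    hence "(\<Sum>k = 1..m. real_of_int (c k) * s (\<beta> k)) \<le> 0"
      using \<beta> by (intro sum_nonpos mult_nonneg_nonpos) (auto simp: less_imp_le)
    moreover have "s \<alpha> = (\<Sum>k = 1..m. real_of_int (c k) * s (\<beta> k))"
      unfolding sum s_def inner_sum_left inner_scaleR_left
      by (subst sum.swap) (simp add: sum_distrib_left)
    moreover have "s \<alpha> = 1" using s_root[of i j] ij by (auto simp: S_def)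
    ultimately show False by simp
  qed
qed

text \<open>Compatibility is applied to \<open>\<epsilon> i - \<epsilon> j = (\<epsilon> i -
  \<epsilon> k) + (\<epsilon> k - \<epsilon> j)\<close>.\<close>

lemma umbrella_free_if_strongly_compatible:
  fixes \<epsilon> :: "nat \<Rightarrow> 'a::euclidean_space"
  assumes \<epsilon>: "bij_betw \<epsilon> {1..l} Basis" and sc: "strongly_compatible l \<epsilon> (Psi l \<epsilon> E)"
  shows "umbrella_free l E"
  unfolding umbrella_free_def
proof (intro allI impI, elim conjE)
  fix i k j :: nat
  assume ikj: "1 \<le> i" "i < k" "k < j" "j \<le> l" "{i, j} \<in> E"
  define \<beta> where "\<beta> n = (if n = 1 then \<epsilon> i - \<epsilon> k else \<epsilon> k - \<epsilon> j)" for n :: nat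
  have "\<epsilon> i - \<epsilon> j \<in> Psi l \<epsilon> E" using ikj root_in_Psi_iff[OF \<epsilon>] by simp
  moreover have "\<forall>n\<in>{1..2}. \<beta> n \<in> pos_roots l \<epsilon> \<and> (1::int) > 0"
    using ikj by (auto simp: \<beta>_def intro!: pos_rootI)
  moreover have "\<epsilon> i - \<epsilon> j = (\<Sum>n = 1..2. of_int 1 *\<^sub>R \<beta> n)"
    by (simp add: \<beta>_def numeral_2_eq_2)
  ultimately have "\<exists>n\<in>{1..2}. \<beta> n \<in> Psi l \<epsilon> E"
    by (intro sc[unfolded strongly_compatible_def, THEN conjunct2, rule_format, of _ 2 \<beta> "\<lambda>_. 1"] conjI)
  then obtain n where "\<beta> n \<in> Psi l \<epsilon> E" by blast
  thus "{i, k} \<in> E \<or> {k, j} \<in> E"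
    using ikj root_in_Psi_iff[OF \<epsilon>] by (auto simp: \<beta>_def split: if_splits)
qed

section \<open>Alcoves of type \<open>A\<close>\<close>

definition off_diag :: "nat \<Rightarrow> (nat \<times> nat) set" where
  "off_diag l = {(i, j). i \<in> {1..l} \<and> j \<in> {1..l} \<and> i \<noteq> j}"

lemma finite_off_diag [simp]: "finite (off_diag l)"
  by (rule finite_subset[of _ "{1..l} \<times> {1..l}"]) (auto simp: off_diag_def)

lemma off_diag_sym: "(i, j) \<in> off_diag l \<Longrightarrow> (j, i) \<in> off_diag l"
  by (auto simp: off_diag_def)

locale type_A =
  fixes l :: nat and \<epsilon> :: "nat \<Rightarrow> 'a::euclidean_space"
  assumes \<epsilon>: "bij_betw \<epsilon> {1..l} Basis"
begin

section \<open>Coordinate differences\<close>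

definition D :: "nat \<Rightarrow> nat \<Rightarrow> 'a \<Rightarrow> real" where "D i j z = (\<epsilon> i - \<epsilon> j) \<bullet> z"

text \<open>For generic \<open>x\<close> and \<open>i < j\<close> these floors are the Shi
  coordinates of its alcove.\<close>

definition K :: "'a \<Rightarrow> nat \<Rightarrow> nat \<Rightarrow> int" where "K x i j = \<lfloor>D i j x\<rfloor>"

lemma D_swap: "D j i z = - D i j z"
  by (simp add: D_def algebra_simps)

lemma D_add: "D i k z + D k j z = D i j z"
  by (simp add: D_def algebra_simps)

lemma U_space_eq: "U_space l \<epsilon> = {z. (\<Sum>i = 1..l. \<epsilon> i) \<bullet> z = 0}"
  unfolding U_space_def by (simp add: inner_sum_left inner_commute[of "\<epsilon> _"])

lemma affine_U: "affine (U_space l \<epsilon>)"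
  unfolding U_space_eq by (rule affine_hyperplane)

lemma convex_U: "convex (U_space l \<epsilon>)"
  using affine_U by (rule affine_imp_convex)

lemma closed_U: "closed (U_space l \<epsilon>)"
  unfolding U_space_eq by (rule closed_hyperplane)

lemma hyperplane_eq: "hyperplane l \<epsilon> (\<epsilon> i - \<epsilon> j) m = U_space l \<epsilon> \<inter> {z. D i j z = of_int m}"
  by (auto simp: hyperplane_def D_def)

lemma affine_D: "affine {z. D i j z = c}"
  unfolding D_def by (rule affine_hyperplane)

text \<open>Subtracting the mean moves the vector with coordinates \<open>f\<close> into
  \<open>U_space\<close> and preserves all coordinate differences.\<close>

definition point :: "(nat \<Rightarrow> real) \<Rightarrow> 'a" where
  "point f = (\<Sum>i = 1..l. (f i - (\<Sum>k = 1..l. f k) / real l) *\<^sub>R \<epsilon> i)"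

lemma point_inner: "j \<in> {1..l} \<Longrightarrow> point f \<bullet> \<epsilon> j = f j - (\<Sum>k = 1..l. f k) / real l"
proof -
  assume j: "j \<in> {1..l}"
  have "point f \<bullet> \<epsilon> j = (\<Sum>i = 1..l. if i = j then f j - (\<Sum>k = 1..l. f k) / real l else 0)"
    unfolding point_def inner_sum_left inner_scaleR_left
    using j by (intro sum.cong) (auto simp: inner_standard_basis[OF \<epsilon>])
  thus ?thesis using j by simp
qed

lemma point_in_U: "point f \<in> U_space l \<epsilon>"
proof -
  have "(\<Sum>j = 1..l. point f \<bullet> \<epsilon> j) = (\<Sum>j = 1..l. f j - (\<Sum>k = 1..l. f k) / real l)"
    by (rule sum.cong) (simp_all add: point_inner)
  also have "\<dots> = 0" by (cases "l = 0") (simp_all add: sum_subtractf)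
  finally show ?thesis by (simp add: U_space_def)
qed

lemma D_point: "i \<in> {1..l} \<Longrightarrow> j \<in> {1..l} \<Longrightarrow> D i j (point f) = f i - f j"
  by (simp add: D_def inner_diff_left inner_commute[of "\<epsilon> _"] point_inner)

section \<open>Alcoves as cells of integral inequalities\<close>

definition generic :: "'a \<Rightarrow> bool" where
  "generic x \<longleftrightarrow> x \<in> U_space l \<epsilon> \<and> (\<forall>(i, j)\<in>off_diag l. D i j x \<notin> \<int>)"

text \<open>Lower bounds for both orders of each pair encode the upper bounds too: at a generic
  \<open>x\<close>, \<open>K x j i = - K x i j - 1\<close>.\<close>

definition cell :: "'a \<Rightarrow> 'a set" where
  "cell x = {z \<in> U_space l \<epsilon>. \<forall>(i, j)\<in>off_diag l. of_int (K x i j) < D i j z}"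

definition closed_cell :: "'a \<Rightarrow> 'a set" where
  "closed_cell x = {z \<in> U_space l \<epsilon>. \<forall>(i, j)\<in>off_diag l. of_int (K x i j) \<le> D i j z}"

lemma cellD: "z \<in> cell x \<Longrightarrow> (i, j) \<in> off_diag l \<Longrightarrow> of_int (K x i j) < D i j z"
  unfolding cell_def by blast

lemma closed_cellD: "z \<in> closed_cell x \<Longrightarrow> (i, j) \<in> off_diag l \<Longrightarrow> of_int (K x i j) \<le> D i j z"
  unfolding closed_cell_def by blast

lemma K_less: "generic x \<Longrightarrow> (i, j) \<in> off_diag l \<Longrightarrow> of_int (K x i j) < D i j x"
  unfolding generic_def K_def by (metis (mono_tags, lifting) Ints_of_int case_prodD floor_correct le_less)

lemma K_swap:
  assumes "generic x" "(i, j) \<in> off_diag l"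
  shows "K x j i = - K x i j - 1"
  using K_less[OF assms] unfolding K_def D_swap[of i j] by linarith

lemma generic_in_cell: "generic x \<Longrightarrow> x \<in> cell x"
  using K_less by (auto simp: cell_def generic_def)

lemma cell_less:
  assumes "generic x" "z \<in> cell x" "(i, j) \<in> off_diag l"
  shows "D i j z < of_int (K x i j) + 1"
  using cellD[OF assms(2) off_diag_sym[OF assms(3)]] K_swap[OF assms(1,3)] D_swap[of i j z] by simp

lemma arrangement_complement:
  "U_space l \<epsilon> - \<Union> (affine_arrangement l \<epsilon>) = {x. generic x}" (is "?S = _")
proof (intro equalityI subsetI)
  fix x assume x: "x \<in> ?S"
  have "D i j x \<notin> \<int>" if ij: "(i, j) \<in> off_diag l" for i j
  proof
    assume "D i j x \<in> \<int>"
    hence "D (min i j) (max i j) x \<in> \<int>"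
      using D_swap[of i j x] by (auto simp: min_def max_def)
    then obtain m where "D (min i j) (max i j) x = of_int m" by (auto simp: Ints_def)
    hence "x \<in> hyperplane l \<epsilon> (\<epsilon> (min i j) - \<epsilon> (max i j)) m"
      using x by (simp add: hyperplane_eq)
    moreover have "\<epsilon> (min i j) - \<epsilon> (max i j) \<in> pos_roots l \<epsilon>"
      using ij by (intro pos_rootI) (auto simp: off_diag_def)
    ultimately show False using x unfolding affine_arrangement_def by blast
  qed
  thus "x \<in> {x. generic x}" using x by (auto simp: generic_def)
next
  fix x assume "x \<in> {x. generic x}"
  hence x: "x \<in> U_space l \<epsilon>" "\<And>i j. (i, j) \<in> off_diag l \<Longrightarrow> D i j x \<notin> \<int>"
    by (auto simp: generic_def)
  have "x \<notin> hyperplane l \<epsilon> (\<epsilon> i - \<epsilon> j) m" if "1 \<le> i" "i < j" "j \<le> l" for i j m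
    using x(2)[of i j] that by (auto simp: hyperplane_eq off_diag_def)
  thus "x \<in> ?S" using x(1) by (auto simp: affine_arrangement_def pos_roots_def)
qed

lemma convex_halfspaces:
  "convex {z. \<forall>(i, j)\<in>P. c i j < D i j z}" "convex {z. \<forall>(i, j)\<in>P. c i j \<le> D i j z}"
proof -
  have "{z. \<forall>(i, j)\<in>P. c i j < D i j z} = (\<Inter>(i, j)\<in>P. {z. D i j z > c i j})"
    "{z. \<forall>(i, j)\<in>P. c i j \<le> D i j z} = (\<Inter>(i, j)\<in>P. {z. D i j z \<ge> c i j})" by auto
  moreover have "convex (\<Inter>(i, j)\<in>P. {z. D i j z > c i j})" "convex (\<Inter>(i, j)\<in>P. {z. D i j z \<ge> c i j})"
    unfolding D_def by (auto intro!: convex_INT simp: convex_halfspace_gt convex_halfspace_ge)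
  ultimately show "convex {z. \<forall>(i, j)\<in>P. c i j < D i j z}" "convex {z. \<forall>(i, j)\<in>P. c i j \<le> D i j z}"
    by simp_all
qed

lemma open_halfspaces: "finite P \<Longrightarrow> open {z. \<forall>(i, j)\<in>P. c i j < D i j z}"
proof -
  assume P: "finite P"
  have "{z. \<forall>(i, j)\<in>P. c i j < D i j z} = (\<Inter>(i, j)\<in>P. {z. D i j z > c i j})" by auto
  moreover have "open (\<Inter>(i, j)\<in>P. {z. D i j z > c i j})"
    unfolding D_def using P by (intro open_INT) (auto simp: open_halfspace_gt)
  ultimately show ?thesis by simp
qed

lemma closed_halfspaces: "closed {z. \<forall>(i, j)\<in>P. c i j \<le> D i j z}"
proof -
  have "{z. \<forall>(i, j)\<in>P. c i j \<le> D i j z} = (\<Inter>(i, j)\<in>P. {z. D i j z \<ge> c i j})" by auto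
  moreover have "closed (\<Inter>(i, j)\<in>P. {z. D i j z \<ge> c i j})"
    unfolding D_def by (intro closed_INT) (auto simp: closed_halfspace_ge)
  ultimately show ?thesis by simp
qed

lemma cell_Int: "cell x = U_space l \<epsilon> \<inter> {z. \<forall>(i, j)\<in>off_diag l. of_int (K x i j) < D i j z}"
  by (auto simp: cell_def)

lemma closed_cell_Int:
  "closed_cell x = U_space l \<epsilon> \<inter> {z. \<forall>(i, j)\<in>off_diag l. of_int (K x i j) \<le> D i j z}"
  by (auto simp: closed_cell_def)

lemma convex_cell: "convex (cell x)"
  unfolding cell_Int by (intro convex_Int convex_U convex_halfspaces)

lemma convex_closed_cell: "convex (closed_cell x)"
  unfolding closed_cell_Int by (intro convex_Int convex_U convex_halfspaces)

lemma closed_closed_cell: "closed (closed_cell x)"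
  unfolding closed_cell_Int by (intro closed_Int closed_U closed_halfspaces)

lemma cell_generic:
  assumes "generic x" "z \<in> cell x"
  shows "generic z"
proof -
  have "D i j z \<notin> \<int>" if ij: "(i, j) \<in> off_diag l" for i j
    using cellD[OF assms(2) ij] cell_less[OF assms ij] by (auto simp: Ints_def)
  thus ?thesis using assms by (auto simp: generic_def cell_def)
qed

text \<open>The cell is convex and avoids all hyperplanes. Conversely, a connected set that leaves
  it crosses a hyperplane, by the intermediate value theorem.\<close>

lemma component_eq_cell:
  assumes x: "generic x"
  shows "connected_component_set {x. generic x} x = cell x"
proof
  show "cell x \<subseteq> connected_component_set {x. generic x} x"
    using cell_generic[OF x] generic_in_cell[OF x] convex_connected[OF convex_cell]
    by (intro connected_component_maximal) auto
next
  let ?T = "connected_component_set {x. generic x} x"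
  have conn: "connected ?T" by simp
  have xT: "x \<in> ?T" using x by simp
  have T: "?T \<subseteq> {x. generic x}" by (rule connected_component_subset)
  show "?T \<subseteq> cell x"
  proof
    fix z assume z: "z \<in> ?T"
    have "of_int (K x i j) < D i j z" if ij: "(i, j) \<in> off_diag l" for i j
    proof (rule ccontr)
      assume "\<not> of_int (K x i j) < D i j z"
      hence "(\<epsilon> i - \<epsilon> j) \<bullet> z \<le> of_int (K x i j)" "of_int (K x i j) \<le> (\<epsilon> i - \<epsilon> j) \<bullet> x"
        using K_less[OF x ij] by (auto simp: D_def)
      from connected_ivt_hyperplane[OF conn z xT this]
      obtain w where w: "w \<in> ?T" "D i j w = of_int (K x i j)" by (auto simp: D_def)
      hence "generic w" using T by blast
      thus False using w(2) ij by (auto simp: generic_def)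
    qed
    thus "z \<in> cell x" using z T by (auto simp: cell_def generic_def)
  qed
qed

lemma alcoves_eq: "alcoves l \<epsilon> = cell ` {x. generic x}"
  unfolding alcoves_def arrangement_complement components_def
  by (rule image_cong) (simp_all add: component_eq_cell)

text \<open>On the open segment from a point of the closed cell to \<open>x\<close>, all
  inequalities become strict.\<close>

lemma closure_cell:
  assumes x: "generic x"
  shows "closure (cell x) = closed_cell x"
proof
  show "closure (cell x) \<subseteq> closed_cell x"
    by (rule closure_minimal[OF _ closed_closed_cell])
      (auto simp: cell_def closed_cell_def intro: less_imp_le)
next
  show "closed_cell x \<subseteq> closure (cell x)"
  proof
    fix z assume z: "z \<in> closed_cell x"
    show "z \<in> closure (cell x)"
    proof (cases "z = x")
      case True
      thus ?thesis using generic_in_cell[OF x] closure_subset by blast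
    next
      case False
      have "open_segment z x \<subseteq> cell x"
      proof
        fix w assume "w \<in> open_segment z x"
        then obtain t where t: "0 < t" "t < 1" "w = (1 - t) *\<^sub>R z + t *\<^sub>R x"
          by (auto simp: in_segment)
        have "w \<in> U_space l \<epsilon>"
          using t z x convexD[OF convex_U, of z x "1 - t" t] by (auto simp: closed_cell_def generic_def)
        moreover have "of_int (K x i j) < D i j w" if ij: "(i, j) \<in> off_diag l" for i j
        proof -
          have "(1 - t) * of_int (K x i j) \<le> (1 - t) * D i j z"
            using closed_cellD[OF z ij] t by (intro mult_left_mono) auto
          moreover have "t * of_int (K x i j) < t * D i j x"
            using K_less[OF x ij] t by (intro mult_strict_left_mono) auto
          moreover have "D i j w = (1 - t) * D i j z + t * D i j x"
            unfolding t(3) D_def by (simp add: inner_add_right)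
          ultimately show ?thesis by (simp add: algebra_simps)
        qed
        ultimately show "w \<in> cell x" by (auto simp: cell_def)
      qed
      hence "closure (open_segment z x) \<subseteq> closure (cell x)" by (rule closure_mono)
      thus ?thesis using False by auto
    qed
  qed
qed

lemma affine_hull_relatively_open:
  fixes H :: "'a set"
  assumes "affine H" "open W" "H \<inter> W \<noteq> {}"
  shows "affine hull (H \<inter> W) = H"
  using affine_hull_openin[of H "H \<inter> W"] assms by (simp add: openin_open_Int hull_same)

lemma aff_dim_closed_cell:
  assumes x: "generic x"
  shows "aff_dim (closed_cell x) = aff_dim (U_space l \<epsilon>)"
proof -
  have "affine hull (cell x) = U_space l \<epsilon>"
    unfolding cell_Int using generic_in_cell[OF x] unfolding cell_Int
    by (intro affine_hull_relatively_open affine_U open_halfspaces) auto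
  hence "aff_dim (cell x) = aff_dim (U_space l \<epsilon>)"
    by (metis aff_dim_affine_hull)
  thus ?thesis by (metis closure_cell[OF x] closure_aff_dim)
qed

section \<open>Walls and adjacent pairs\<close>

text \<open>The residues modulo 1 of the coordinates of a generic point are cyclically ordered;
  \<open>adjacent x u v\<close> says that \<open>v\<close> is the immediate successor of \<open>u\<close> in descending cyclic order.\<close>

definition adjacent :: "'a \<Rightarrow> nat \<Rightarrow> nat \<Rightarrow> bool" where
  "adjacent x u v \<longleftrightarrow> (\<forall>w\<in>{1..l} - {u, v}. K x u v \<noteq> K x u w + K x w v)"

text \<open>It suffices to find a point on the hyperplane that satisfies all other inequalities
  strictly: the face then contains a nonempty relatively open part of the hyperplane.\<close>

lemma facet_if_adjacent:
  assumes x: "generic x" and uv: "(u, v) \<in> off_diag l" and adj: "adjacent x u v"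
  shows "(closed_cell x \<inter> {z. D u v z = of_int (K x u v)}) facet_of closed_cell x"
proof -
  let ?C = "closed_cell x" and ?H = "U_space l \<epsilon> \<inter> {z. D u v z = of_int (K x u v)}"
  let ?F = "?C \<inter> {z. D u v z = of_int (K x u v)}"
  let ?W = "{z. \<forall>(i, j)\<in>off_diag l - {(u, v)}. of_int (K x i j) < D i j z}"
  have face: "?F face_of ?C"
    unfolding D_def
    by (rule face_of_Int_supporting_hyperplane_ge[OF convex_closed_cell])
      (use closed_cellD[OF _ uv, of _ x] in \<open>auto simp: D_def\<close>)
  \<comment> \<open>Coordinate \<open>v\<close> is raised until the inequality for
    \<open>(u, v)\<close> becomes an equality; only inequalities with second index \<open>v\<close>
    can suffer.\<close>
  define f where "f i = x \<bullet> \<epsilon> i + (if i = v then D u v x - of_int (K x u v) else 0)" for i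
  have Dx: "D i j x = x \<bullet> \<epsilon> i - x \<bullet> \<epsilon> j" for i j
    by (simp add: D_def inner_diff_left inner_commute[of "\<epsilon> _"])
  have Kx: "of_int (K x u v) < D u v x" using K_less[OF x uv] .
  have Df: "D i j (point f) = D i j x + (if i = v then D u v x - of_int (K x u v) else 0)
      - (if j = v then D u v x - of_int (K x u v) else 0)" if "(i, j) \<in> off_diag l" for i j
    using that by (auto simp: off_diag_def D_point f_def Dx)
  have "of_int (K x i j) < D i j (point f)" if ij: "(i, j) \<in> off_diag l" "(i, j) \<noteq> (u, v)" for i j
  proof (cases "j = v")
    case False
    thus ?thesis using Df[OF ij(1)] K_less[OF x ij(1)] Kx by auto
  next
    case True
    hence iu: "i \<in> {1..l} - {u, v}" "i \<noteq> v" "(u, i) \<in> off_diag l" using ij uv by (auto simp: off_diag_def)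
    hence ne: "K x u v \<noteq> K x u i + K x i v" using adj by (auto simp: adjacent_def)
    have "of_int (K x u i) < D u i x" "D u i x < of_int (K x u i) + 1"
      using K_less[OF x iu(3)] by (auto simp: K_def)
    moreover have "D u v x < of_int (K x u v) + 1" "D i v x < of_int (K x i v) + 1"
      by (auto simp: K_def)
    moreover have "of_int (K x i v) < D i v x" using K_less[OF x ij(1)] True by simp
    moreover note Kx D_add[of u i x v]
    \<comment> \<open>Since \<open>i\<close> does not split the pair, the floors fall short by 1.
      The fractional part of \<open>D i v x\<close> therefore exceeds the amount by which
      \<open>v\<close> was raised.\<close>
    moreover from calculation have "K x u v = K x u i + K x i v + 1" using ne by linarith
    ultimately show ?thesis using Df[OF ij(1)] True iu by simp
  qed
  hence pW: "point f \<in> ?W" by auto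
  moreover have "point f \<in> ?H"
    using Df[OF uv] uv point_in_U by (auto simp: off_diag_def)
  ultimately have ne: "?H \<inter> ?W \<noteq> {}" by blast
  have affH: "affine ?H" by (intro affine_Int affine_U affine_D)
  have hull: "affine hull (?H \<inter> ?W) = ?H"
    using ne affH by (intro affine_hull_relatively_open open_halfspaces) auto
  have sub: "?H \<inter> ?W \<subseteq> ?F" "?F \<subseteq> ?H"
    by (fastforce simp: closed_cell_def intro: less_imp_le)+
  have "aff_dim ?F = aff_dim ?H"
  proof (rule antisym)
    show "aff_dim ?F \<le> aff_dim ?H" by (rule aff_dim_subset[OF sub(2)])
    show "aff_dim ?H \<le> aff_dim ?F"
      using aff_dim_subset[OF sub(1)] aff_dim_affine_hull[of "?H \<inter> ?W"] hull by simp
  qed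
  also have "\<dots> = aff_dim (U_space l \<epsilon>) - 1"
  proof -
    have "x \<in> U_space l \<epsilon>" "x \<notin> {z. D u v z = of_int (K x u v)}"
      using x Kx by (auto simp: generic_def)
    thus ?thesis
      using aff_dim_affine_Int_hyperplane[OF affine_U, of "\<epsilon> u - \<epsilon> v" "of_int (K x u v)"] ne
      unfolding D_def by auto
  qed
  finally have "aff_dim ?F = aff_dim ?C - 1" using aff_dim_closed_cell[OF x] by simp
  thus ?thesis using face ne sub(1) unfolding facet_of_def by blast
qed

text \<open>Equality for \<open>(u, v)\<close> forces equality for \<open>(u, w)\<close>, so the
  face lies in two distinct hyperplanes and has codimension at least 2.\<close>

lemma not_facet_if_between:
  assumes x: "generic x" and uwv: "u \<in> {1..l}" "w \<in> {1..l}" "v \<in> {1..l}" "u \<noteq> v" "u \<noteq> w" "w \<noteq> v"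
    and between: "K x u v = K x u w + K x w v"
  shows "\<not> (closed_cell x \<inter> {z. D u v z = of_int (K x u v)}) facet_of closed_cell x"
proof
  let ?C = "closed_cell x" and ?H = "U_space l \<epsilon> \<inter> {z. D u v z = of_int (K x u v)}"
  let ?F = "?C \<inter> {z. D u v z = of_int (K x u v)}" and ?G = "{z. D u w z = of_int (K x u w)}"
  assume facet: "?F facet_of ?C"
  have sub: "?F \<subseteq> ?H \<inter> ?G"
  proof
    fix z assume z: "z \<in> ?F"
    hence "of_int (K x u w) \<le> D u w z" "of_int (K x w v) \<le> D w v z" "D u v z = of_int (K x u v)"
      using uwv by (auto intro!: closed_cellD simp: off_diag_def)
    hence "D u w z = of_int (K x u w)" using between D_add[of u w z v] by linarith
    thus "z \<in> ?H \<inter> ?G" using z by (auto simp: closed_cell_def)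
  qed
  \<comment> \<open>This point has \<open>D u v = K x u v\<close> but
    \<open>D u w = K x u w + 1\<close>, which tells the two hyperplanes apart.\<close>
  define f where "f i = (if i = u then of_int (K x u v) else if i = w then of_int (K x u v) - of_int (K x u w) - 1 else 0 :: real)" for i
  have f: "point f \<in> ?H" "point f \<notin> ?G"
    using uwv point_in_U by (auto simp: D_point f_def)
  have "aff_dim ?F \<le> aff_dim (?H \<inter> ?G)" by (rule aff_dim_subset[OF sub])
  also have "\<dots> = aff_dim ?H - 1"
  proof -
    have "?F \<noteq> {}" using facet by (simp add: facet_of_def)
    hence "?H \<inter> ?G \<noteq> {}" using sub by blast
    moreover have "affine ?H" by (intro affine_Int affine_U affine_D)
    ultimately show ?thesis
      using aff_dim_affine_Int_hyperplane[of ?H "\<epsilon> u - \<epsilon> w" "of_int (K x u w)"] f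
      unfolding D_def by auto
  qed
  also have "aff_dim ?H = aff_dim (U_space l \<epsilon>) - 1"
  proof -
    have "x \<in> U_space l \<epsilon>" "x \<notin> {z. D u v z = of_int (K x u v)}"
      using x K_less[OF x, of u v] uwv by (auto simp: generic_def off_diag_def)
    thus ?thesis
      using aff_dim_affine_Int_hyperplane[OF affine_U, of "\<epsilon> u - \<epsilon> v" "of_int (K x u v)"] f
      unfolding D_def by auto
  qed
  finally show False using facet aff_dim_closed_cell[OF x] by (simp add: facet_of_def)
qed

section \<open>Descent along tight pairs\<close>

lemma tight_between:
  assumes "z \<in> closed_cell x" "D u v z = of_int (K x u v)" "K x u v = K x u w + K x w v"
    and "(u, w) \<in> off_diag l" "(w, v) \<in> off_diag l"
  shows "D u w z = of_int (K x u w)" "D w v z = of_int (K x w v)"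
  using closed_cellD[OF assms(1,4)] closed_cellD[OF assms(1,5)] assms(2,3) D_add[of u w z v] by auto

text \<open>A natural number that orders the pairs by fractional part, as a measure for
  induction.\<close>

definition frac_rank :: "'a \<Rightarrow> nat \<Rightarrow> nat \<Rightarrow> nat" where
  "frac_rank x u v = card {p \<in> off_diag l. frac (D (fst p) (snd p) x) < frac (D u v x)}"

lemma frac_rank_less:
  assumes "(u, v) \<in> off_diag l" "frac (D u v x) < frac (D u' v' x)"
  shows "frac_rank x u v < frac_rank x u' v'"
  unfolding frac_rank_def
proof (rule psubset_card_mono)
  show "{p \<in> off_diag l. frac (D (fst p) (snd p) x) < frac (D u v x)}
      \<subset> {p \<in> off_diag l. frac (D (fst p) (snd p) x) < frac (D u' v' x)}"
    using assms by force
qed simp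

text \<open>If the floors add up, so do the fractional parts, and both summands are positive by
  genericity.\<close>

lemma frac_rank_between:
  assumes x: "generic x" and "K x u v = K x u w + K x w v"
    and uw: "(u, w) \<in> off_diag l" and wv: "(w, v) \<in> off_diag l"
  shows "frac_rank x u w < frac_rank x u v" "frac_rank x w v < frac_rank x u v"
  using assms(2) K_less[OF x uw] K_less[OF x wv] D_add[of u w x v]
  by (auto intro!: frac_rank_less uw wv simp: frac_def K_def)

text \<open>A tight pair that is not adjacent splits into two tight pairs of smaller rank. If
  \<open>u < v\<close>, at least one of the halves ascends again, and the descent follows that
  one.\<close>

lemma ex_adjacent_tight:
  assumes x: "generic x" and z: "z \<in> closed_cell x"
    and "(u, v) \<in> off_diag l" "D u v z = of_int (K x u v)"
  shows "\<exists>u' v'. (u', v') \<in> off_diag l \<and> adjacent x u' v' \<and> D u' v' z = of_int (K x u' v') \<and>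
    (u < v \<longrightarrow> u' < v')"
  using assms(3,4)
proof (induction "frac_rank x u v" arbitrary: u v rule: less_induct)
  case less
  show ?case
  proof (cases "adjacent x u v")
    case False
    then obtain w where w: "w \<in> {1..l}" "w \<noteq> u" "w \<noteq> v" "K x u v = K x u w + K x w v"
      unfolding adjacent_def by blast
    hence uw: "(u, w) \<in> off_diag l" and wv: "(w, v) \<in> off_diag l"
      using less.prems by (auto simp: off_diag_def)
    note tight = tight_between[OF z less.prems(2) w(4) uw wv]
    note r = frac_rank_between[OF x w(4) uw wv]
    show ?thesis
      using less.hyps[OF r(1) uw tight(1)] less.hyps[OF r(2) wv tight(2)] w(2)
      by (cases "u < w") (force+)
  qed (use less.prems in blast)
qed

text \<open>Membership in \<open>ceilings\<close> only provides some root and integer for a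
  hyperplane; they have to be recovered from the set.\<close>

lemma hyperplane_eq_imp:
  assumes eq: "hyperplane l \<epsilon> (\<epsilon> i - \<epsilon> j) m = hyperplane l \<epsilon> (\<epsilon> i' - \<epsilon> j') m'"
    and ij: "1 \<le> i" "i < j" "j \<le> l" and ij': "1 \<le> i'" "i' < j'" "j' \<le> l"
  shows "i' = i \<and> j' = j \<and> m' = m"
proof -
  \<comment> \<open>Off \<open>i\<close> and \<open>j\<close>, the coordinate at \<open>k\<close> is
    free; varying it forces \<open>i'\<close> and \<open>j'\<close> into
    \<open>{i, j}\<close>.\<close>
  define f where "f k s t = (if t = i then of_int m else if t = j then 0 else if t = k then s else 0 :: real)"
    for k t :: nat and s :: real
  have "point (f k s) \<in> hyperplane l \<epsilon> (\<epsilon> i - \<epsilon> j) m" for k s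
    using ij point_in_U by (auto simp: hyperplane_eq D_point f_def)
  hence *: "f k s i' - f k s j' = of_int m'" for k s
    using ij' unfolding eq by (auto simp: hyperplane_eq D_point)
  have "i' \<in> {i, j}" using *[of i' 0] *[of i' 1] ij' by (auto simp: f_def split: if_splits)
  moreover have "j' \<in> {i, j}" using *[of j' 0] *[of j' 1] ij' by (auto simp: f_def split: if_splits)
  ultimately have "i' = i" "j' = j" using ij ij' by auto
  thus ?thesis using *[of i 0] ij by (auto simp: f_def)
qed

lemma Collect_D_swap:
  assumes "generic x" "(u, v) \<in> off_diag l"
  shows "{z. D u v z = of_int (K x u v)} = {z. D v u z = of_int (K x v u + 1)}"
  using K_swap[OF assms] by (auto simp: D_swap[of u v])

lemma closed_cell_Int_hyperplane:
  "closed_cell x \<inter> hyperplane l \<epsilon> (\<epsilon> u - \<epsilon> v) m = closed_cell x \<inter> {z. D u v z = of_int m}"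
  by (auto simp: hyperplane_eq closed_cell_def)

end

section \<open>Worpitzky compatibility\<close>

lemma Psi_iff: "\<alpha> \<in> Psi l \<epsilon> E \<longleftrightarrow> (\<exists>i j. \<alpha> = \<epsilon> i - \<epsilon> j \<and> 1 \<le> i \<and> i < j \<and> j \<le> l \<and> {i, j} \<in> E)"
  unfolding Psi_def by blast

context type_A
begin

section \<open>Points of the half-open alcove\<close>

lemma P_half_open_less:
  assumes z: "z \<in> P_half_open l \<epsilon>" and ij: "1 \<le> i" "i < j" "j \<le> l"
  shows "0 < D i j z"
proof -
  have consec: "0 < D k (Suc k) z" if "k \<in> {1..<l}" for k
    using z that by (auto simp: P_half_open_def simple_root_def D_def)
  have "Suc i \<le> j" using ij by simp
  thus ?thesis
    using \<open>j \<le> l\<close>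
  proof (induction j rule: dec_induct)
    case base
    thus ?case using consec[of i] ij by simp
  next
    case (step k)
    thus ?case using consec[of k] D_add[of i k z "Suc k"] by simp
  qed
qed

lemma K_nonneg:
  assumes "cell x \<subseteq> P_half_open l \<epsilon>" "generic x" "1 \<le> i" "i < j" "j \<le> l"
  shows "0 \<le> K x i j"
  using P_half_open_less[OF _ assms(3-5), of x] assms(1) generic_in_cell[OF assms(2)]
  by (auto simp: K_def le_floor_iff)

text \<open>A tight ascending pair is a lower bound for a positive root; a tight descending pair
  becomes an upper bound after reversal, at level \<open>K x v u + 1\<close>.\<close>

lemma wall_if_adjacent:
  assumes x: "generic x" and uv: "(u, v) \<in> off_diag l" and adj: "adjacent x u v"
  shows "u < v \<Longrightarrow> hyperplane l \<epsilon> (\<epsilon> u - \<epsilon> v) (K x u v) \<in> walls l \<epsilon> (cell x)"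
    and "v < u \<Longrightarrow> hyperplane l \<epsilon> (\<epsilon> v - \<epsilon> u) (K x v u + 1) \<in> walls l \<epsilon> (cell x)"
proof -
  note facet = facet_if_adjacent[OF assms]
  show "hyperplane l \<epsilon> (\<epsilon> u - \<epsilon> v) (K x u v) \<in> walls l \<epsilon> (cell x)" if "u < v"
  proof -
    have "\<epsilon> u - \<epsilon> v \<in> pos_roots l \<epsilon>" using uv that by (intro pos_rootI) (auto simp: off_diag_def)
    thus ?thesis
      using facet unfolding walls_def affine_arrangement_def closure_cell[OF x]
      by (auto simp: closed_cell_Int_hyperplane)
  qed
  show "hyperplane l \<epsilon> (\<epsilon> v - \<epsilon> u) (K x v u + 1) \<in> walls l \<epsilon> (cell x)" if "v < u"
  proof -
    have "\<epsilon> v - \<epsilon> u \<in> pos_roots l \<epsilon>" using uv that by (intro pos_rootI) (auto simp: off_diag_def)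
    thus ?thesis
      using facet unfolding walls_def affine_arrangement_def closure_cell[OF x] Collect_D_swap[OF x uv]
      by (auto simp: closed_cell_Int_hyperplane)
  qed
qed

lemma upper_closure_in_closed_cell:
  "generic x \<Longrightarrow> upper_closure l \<epsilon> (cell x) \<subseteq> closed_cell x"
  unfolding upper_closure_def using closure_subset[of "cell x"] closure_cell[of x] by auto

text \<open>The descent to an ascending adjacent pair produces a wall through \<open>z\<close> that
  bounds the alcove from below. As the floors are nonnegative in \<open>P_half_open\<close>, it is
  no ceiling, so \<open>upper_closure\<close> excludes \<open>z\<close>.\<close>

lemma upper_closure_not_on_floor:
  assumes x: "generic x" and P: "cell x \<subseteq> P_half_open l \<epsilon>" and z: "z \<in> upper_closure l \<epsilon> (cell x)"
    and ij: "1 \<le> i" "i < j" "j \<le> l"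
  shows "D i j z \<noteq> of_int (K x i j)"
proof
  assume tight: "D i j z = of_int (K x i j)"
  have "(i, j) \<in> off_diag l" using ij by (auto simp: off_diag_def)
  hence "z \<notin> cell x" using cellD[of z x i j] tight by auto
  from ex_adjacent_tight[OF x _ \<open>(i, j) \<in> off_diag l\<close> tight]
  obtain u v where uv: "(u, v) \<in> off_diag l" "adjacent x u v" "D u v z = of_int (K x u v)" "u < v"
    using upper_closure_in_closed_cell[OF x] z ij by blast
  let ?H = "hyperplane l \<epsilon> (\<epsilon> u - \<epsilon> v) (K x u v)"
  have "1 \<le> u" "v \<le> l" using uv by (auto simp: off_diag_def)
  have wall: "?H \<in> walls l \<epsilon> (cell x)" using wall_if_adjacent(1)[OF x uv(1,2,4)] .
  have "?H \<notin> ceilings l \<epsilon> (cell x)"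
  proof
    assume "?H \<in> ceilings l \<epsilon> (cell x)"
    then obtain \<alpha> m where H: "?H = hyperplane l \<epsilon> \<alpha> m" "\<alpha> \<in> pos_roots l \<epsilon>"
      "0 \<notin> hyperplane l \<epsilon> \<alpha> m" "\<forall>y\<in>cell x. \<alpha> \<bullet> y < of_int m \<longleftrightarrow> \<alpha> \<bullet> 0 < of_int m"
      unfolding ceilings_def by blast
    then obtain p q where pq: "\<alpha> = \<epsilon> p - \<epsilon> q" "1 \<le> p" "p < q" "q \<le> l" unfolding pos_roots_def by blast
    have "p = u" "q = v" "m = K x u v"
      using hyperplane_eq_imp[OF H(1)[unfolded pq(1)]] uv \<open>1 \<le> u\<close> \<open>v \<le> l\<close> pq by auto
    hence "\<not> \<alpha> \<bullet> x < of_int m" using K_less[OF x uv(1)] pq by (simp add: D_def)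
    hence "m \<le> 0" using H(4) generic_in_cell[OF x] by auto
    moreover have "m \<noteq> 0" using H(3) by (auto simp: hyperplane_def U_space_def)
    moreover have "0 \<le> m" using K_nonneg[OF P x \<open>1 \<le> u\<close> uv(4) \<open>v \<le> l\<close>] \<open>m = _\<close> by simp
    ultimately show False by simp
  qed
  moreover have "z \<in> ?H"
    using uv(3) z upper_closure_in_closed_cell[OF x] by (auto simp: hyperplane_eq closed_cell_def)
  ultimately show False
    using z \<open>z \<notin> cell x\<close> wall unfolding upper_closure_def by blast
qed

text \<open>As in \<open>ex_adjacent_tight\<close>, but following a half that is an edge. The point
  \<open>y\<close> forces tight pairs to descend, which puts \<open>w\<close> between
  \<open>v\<close> and \<open>u\<close> and makes the umbrella condition applicable. The claim for
  all \<open>z\<close> lets one ceiling serve a whole intersection.\<close>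

lemma ex_adjacent_edge:
  assumes x: "generic x" and uf: "umbrella_free l E"
    and y: "y \<in> closed_cell x" "\<And>i j. 1 \<le> i \<Longrightarrow> i < j \<Longrightarrow> j \<le> l \<Longrightarrow> D i j y \<noteq> of_int (K x i j)"
    and "(u, v) \<in> off_diag l" "{u, v} \<in> E" "D u v y = of_int (K x u v)"
  shows "\<exists>u' v'. (u', v') \<in> off_diag l \<and> v' < u' \<and> {u', v'} \<in> E \<and> adjacent x u' v' \<and>
    (\<forall>z\<in>closed_cell x. D u v z = of_int (K x u v) \<longrightarrow> D u' v' z = of_int (K x u' v'))"
  using assms(5-7)
proof (induction "frac_rank x u v" arbitrary: u v rule: less_induct)
  case less
  have desc: "j < i" if "(i, j) \<in> off_diag l" "D i j y = of_int (K x i j)" for i j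
    using y(2)[of i j] that by (fastforce simp: off_diag_def)
  show ?case
  proof (cases "adjacent x u v")
    case True
    thus ?thesis using less.prems desc[OF less.prems(1,3)] by blast
  next
    case False
    then obtain w where w: "w \<in> {1..l}" "w \<noteq> u" "w \<noteq> v" "K x u v = K x u w + K x w v"
      unfolding adjacent_def by blast
    hence uw: "(u, w) \<in> off_diag l" and wv: "(w, v) \<in> off_diag l"
      using less.prems by (auto simp: off_diag_def)
    note tight = tight_between[OF _ _ w(4) uw wv]
    note r = frac_rank_between[OF x w(4) uw wv]
    have "v < w" "w < u"
      using desc[OF uw tight(1)[OF y(1) less.prems(3)]] desc[OF wv tight(2)[OF y(1) less.prems(3)]]
      by auto
    hence "{v, w} \<in> E \<or> {w, u} \<in> E"
      using umbrella_freeD[OF uf, of v w u] less.prems by (auto simp: off_diag_def insert_commute)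
    thus ?thesis
    proof
      assume "{v, w} \<in> E"
      hence "{w, v} \<in> E" by (simp add: insert_commute)
      from less.hyps[OF r(2) wv this tight(2)[OF y(1) less.prems(3)]] show ?thesis
        using tight(2) by meson
    next
      assume "{w, u} \<in> E"
      hence "{u, w} \<in> E" by (simp add: insert_commute)
      from less.hyps[OF r(1) uw this tight(1)[OF y(1) less.prems(3)]] show ?thesis
        using tight(1) by meson
    qed
  qed
qed

lemma Worpitzky_compatible_if_umbrella_free:
  assumes uf: "umbrella_free l E"
  shows "Worpitzky_compatible l \<epsilon> (Psi l \<epsilon> E)"
  unfolding Worpitzky_compatible_def
proof (intro conjI Psi_subset_pos_roots ballI impI allI)
  fix A \<alpha> m
  assume A: "A \<in> alcoves l \<epsilon>" and AP: "A \<subseteq> P_half_open l \<epsilon>" and \<alpha>: "\<alpha> \<in> Psi l \<epsilon> E"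
  obtain x where x: "generic x" "A = cell x" using A unfolding alcoves_eq by blast
  have P: "cell x \<subseteq> P_half_open l \<epsilon>" using AP x by simp
  obtain a b where ab: "\<alpha> = \<epsilon> a - \<epsilon> b" "1 \<le> a" "a < b" "b \<le> l" "{a, b} \<in> E"
    using \<alpha> unfolding Psi_iff by blast
  have ba: "(b, a) \<in> off_diag l" and ab': "(a, b) \<in> off_diag l" using ab by (auto simp: off_diag_def)
  let ?UC = "upper_closure l \<epsilon> A"
  have UC: "?UC \<subseteq> closed_cell x" using upper_closure_in_closed_cell[OF x(1)] x(2) by simp
  \<comment> \<open>On the closed cell, \<open>\<alpha>\<close> ranges between two consecutive
    integers. The lower one is excluded, so \<open>m\<close> is the upper one and the reversed pair
    is tight.\<close>
  have tight: "D b a z = of_int (K x b a)" if z: "z \<in> ?UC \<inter> hyperplane l \<epsilon> \<alpha> m" for z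
  proof -
    have zC: "z \<in> closed_cell x" using z UC by blast
    have "D a b z = of_int m" using z by (simp add: ab(1) hyperplane_eq)
    moreover have "D a b z \<noteq> of_int (K x a b)"
      using upper_closure_not_on_floor[OF x(1) P _ ab(2-4)] z x(2) by blast
    ultimately show ?thesis
      using closed_cellD[OF zC ab'] closed_cellD[OF zC ba] K_swap[OF x(1) ab'] D_swap[of a b z] by simp
  qed
  show "?UC \<inter> hyperplane l \<epsilon> \<alpha> m = {} \<or> (\<exists>\<beta>\<in>Psi l \<epsilon> E. \<exists>m'. hyperplane l \<epsilon> \<beta> m' \<in> ceilings l \<epsilon> A \<and>
      ?UC \<inter> hyperplane l \<epsilon> \<alpha> m \<subseteq> hyperplane l \<epsilon> \<beta> m')"
  proof (cases "?UC \<inter> hyperplane l \<epsilon> \<alpha> m = {}")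
    case False
    then obtain y where y: "y \<in> ?UC \<inter> hyperplane l \<epsilon> \<alpha> m" by blast
    have "\<exists>u' v'. (u', v') \<in> off_diag l \<and> v' < u' \<and> {u', v'} \<in> E \<and> adjacent x u' v' \<and>
      (\<forall>z\<in>closed_cell x. D b a z = of_int (K x b a) \<longrightarrow> D u' v' z = of_int (K x u' v'))"
      using y UC upper_closure_not_on_floor[OF x(1) P] ab(5) tight[OF y] x(2)
      by (intro ex_adjacent_edge[OF x(1) uf _ _ ba, of y]) (auto simp: insert_commute)
    then obtain u v where uv: "(u, v) \<in> off_diag l" "v < u" "{u, v} \<in> E" "adjacent x u v"
      "\<And>z. z \<in> closed_cell x \<Longrightarrow> D b a z = of_int (K x b a) \<Longrightarrow> D u v z = of_int (K x u v)"
      by blast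
    have bounds: "1 \<le> v" "u \<le> l" and vu: "(v, u) \<in> off_diag l" using uv(1) by (auto simp: off_diag_def)
    let ?\<beta> = "\<epsilon> v - \<epsilon> u" and ?m = "K x v u + 1"
    \<comment> \<open>This puts the origin strictly below the level \<open>?m\<close>, on the side
      of the alcove.\<close>
    have nonneg: "0 \<le> K x v u" using K_nonneg[OF P x(1) bounds(1) uv(2) bounds(2)] .
    have \<beta>: "?\<beta> \<in> Psi l \<epsilon> E" using uv(2,3) bounds root_in_Psi_iff[OF \<epsilon>, of v u] by (simp add: insert_commute)
    have "hyperplane l \<epsilon> ?\<beta> ?m \<in> ceilings l \<epsilon> A"
    proof -
      have "hyperplane l \<epsilon> ?\<beta> ?m \<in> walls l \<epsilon> A"
        using wall_if_adjacent(2)[OF x(1) uv(1,4,2)] x(2) by simp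
      moreover have "0 \<notin> hyperplane l \<epsilon> ?\<beta> ?m" using nonneg by (auto simp: hyperplane_def)
      moreover have "\<forall>z\<in>A. ?\<beta> \<bullet> z < of_int ?m \<longleftrightarrow> ?\<beta> \<bullet> 0 < of_int ?m"
        using cell_less[OF x(1) _ vu] x(2) nonneg by (auto simp: D_def)
      ultimately show ?thesis
        using \<beta> Psi_subset_pos_roots[of l \<epsilon> E] unfolding ceilings_def by blast
    qed
    moreover have "?UC \<inter> hyperplane l \<epsilon> \<alpha> m \<subseteq> hyperplane l \<epsilon> ?\<beta> ?m"
    proof
      fix z assume z: "z \<in> ?UC \<inter> hyperplane l \<epsilon> \<alpha> m"
      have zC: "z \<in> closed_cell x" using z UC by blast
      have "z \<in> {z. D u v z = of_int (K x u v)}" using uv(5)[OF zC tight[OF z]] by simp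
      thus "z \<in> hyperplane l \<epsilon> ?\<beta> ?m"
        using zC unfolding Collect_D_swap[OF x(1) uv(1)] hyperplane_eq by (auto simp: closed_cell_def)
    qed
    ultimately show ?thesis using \<beta> by blast
  qed blast
qed

section \<open>An umbrella destroys compatibility\<close>

lemma floor_diff_of_int_add:
  fixes r s :: real
  assumes "0 \<le> r" "r < 1" "0 \<le> s" "s < 1"
  shows "\<lfloor>(of_int m + r) - (of_int n + s)\<rfloor> = m - n - (if r < s then 1 else 0)"
  using assms by (auto intro!: floor_unique)

lemma of_int_diff_notin_Ints:
  fixes r s :: real
  assumes "0 \<le> r" "r < 1" "0 \<le> s" "s < 1" "r \<noteq> s"
  shows "(of_int m + r) - (of_int n + s) \<notin> \<int>"
proof
  assume "(of_int m + r) - (of_int n + s) \<in> \<int>"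
  then obtain k where "(of_int m + r) - (of_int n + s) = of_int k" by (auto simp: Ints_def)
  hence "r - s = of_int (k + n - m)" by simp
  moreover from this have "-1 < k + n - m" "k + n - m < 1" using assms by linarith+
  hence "k + n - m = 0" by simp
  ultimately show False using assms by simp
qed

text \<open>Given an umbrella \<open>a < b < c\<close>, the point \<open>y\<close> is chosen with coordinates \<open>2, 1, 0\<close> at
  \<open>a, b, c\<close> and generic otherwise; the alcove lies just below \<open>y\<close>, in which
  \<open>c, b, a\<close> are consecutive in the cyclic order.\<close>

lemma umbrella_free_if_Worpitzky_compatible:
  assumes W: "Worpitzky_compatible l \<epsilon> (Psi l \<epsilon> E)"
  shows "umbrella_free l E"
proof (rule ccontr)
  assume "\<not> umbrella_free l E"
  then obtain a b c where abc: "1 \<le> a" "a < b" "b < c" "c \<le> l" "{a, c} \<in> E"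
    "{a, b} \<notin> E" "{b, c} \<notin> E"
    unfolding umbrella_free_def by blast
  \<comment> \<open>An umbrella needs three vertices, so \<open>e\<close> is at most 1/4. The
    residues \<open>h i\<close> decrease strictly with \<open>i\<close> within
    \<open>[e, 1 - e]\<close>.\<close>
  define e :: real where "e = 1 / real (l + 1)"
  have e: "0 < e" "e \<le> 1 / 4" "real (l + 1) * e = 1" using abc by (auto simp: e_def field_simps)
  define h where "h i = 1 - real i * e" for i :: nat
  have h: "e \<le> h i \<and> h i \<le> 1 - e" if "i \<in> {1..l}" for i
  proof -
    have "1 * e \<le> real i * e" "real i * e \<le> real l * e"
      using that e by (auto intro!: mult_right_mono)
    thus ?thesis using e(3) by (simp add: h_def algebra_simps)
  qed
  have h_Suc: "h (Suc i) = h i - e" for i by (simp add: h_def algebra_simps)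
  have h_inj: "h i = h j \<longleftrightarrow> i = j" for i j using e by (simp add: h_def)
  \<comment> \<open>The integer part drops by 1 exactly where \<open>r\<close> rises: on entering
    \<open>a\<close>, on entering \<open>b\<close> and on leaving \<open>c\<close>. Hence
    differences of consecutive coordinates of \<open>x\<close> have floor 0.\<close>
  define N :: "nat \<Rightarrow> int" where "N i = (if i < a then 2 else if i < b then 1 else if i \<le> c then 0 else -1)" for i
  \<comment> \<open>Compared with \<open>s\<close>, coordinate \<open>a\<close> is lowered by
    \<open>e / 2\<close> and \<open>b\<close> by \<open>e / 4\<close>. So \<open>x\<close> lies just
    below the levels 1, 1, 2 that \<open>y\<close> attains on the pairs \<open>(a, b)\<close>,
    \<open>(b, c)\<close>, \<open>(a, c)\<close>.\<close>
  define r where "r i = (if i = a then 1 - e / 2 else if i = b then 1 - e / 4 else if i = c then 0 else h i)" for i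
  define s where "s i = (if i = a \<or> i = b then 1 else if i = c then 0 else h i)" for i
  define x where "x = point (\<lambda>i. of_int (N i) + r i)"
  define y where "y = point (\<lambda>i. of_int (N i) + s i)"
  have r: "0 \<le> r i" "r i < 1" if "i \<in> {1..l}" for i
    using h[OF that] e by (auto simp: r_def)
  have r_inj: "r i \<noteq> r j" if "(i, j) \<in> off_diag l" for i j
    using h[of i] h[of j] h_inj[of i j] that e by (auto simp: r_def off_diag_def)
  have Dx: "D i j x = (of_int (N i) + r i) - (of_int (N j) + r j)" if "(i, j) \<in> off_diag l" for i j
    using that by (auto simp: x_def D_point off_diag_def)
  have Dy: "D i j y = (of_int (N i) + s i) - (of_int (N j) + s j)" if "(i, j) \<in> off_diag l" for i j
    using that by (auto simp: y_def D_point off_diag_def)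
  have Kx: "K x i j = N i - N j - (if r i < r j then 1 else 0)" if "(i, j) \<in> off_diag l" for i j
    unfolding K_def Dx[OF that] using that r
    by (intro floor_diff_of_int_add) (auto simp: off_diag_def)
  have x: "generic x"
    unfolding generic_def
  proof (intro conjI ballI, unfold split_paired_all prod.case)
    show "x \<in> U_space l \<epsilon>" by (simp add: x_def point_in_U)
    fix i j assume ij: "(i, j) \<in> off_diag l"
    show "D i j x \<notin> \<int>"
      unfolding Dx[OF ij] using ij r r_inj[OF ij]
      by (intro of_int_diff_notin_Ints) (auto simp: off_diag_def)
  qed
  have yU: "y \<in> U_space l \<epsilon>" by (simp add: y_def point_in_U)
  have y: "y \<in> closed_cell x"
  proof -
    have "of_int (K x i j) \<le> D i j y" if ij: "(i, j) \<in> off_diag l" for i j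
    proof -
      have s01: "0 \<le> s i" "s j \<le> 1" using h[of i] h[of j] ij e by (auto simp: s_def off_diag_def)
      \<comment> \<open>Rounding keeps the weak order of the residues, and so the floor bounds
        survive.\<close>
      have "s j \<le> s i" if "r j \<le> r i"
        using that h[of i] h[of j] ij e by (auto simp: s_def r_def off_diag_def split: if_splits)
      thus ?thesis unfolding Kx[OF ij] Dy[OF ij] using s01 by auto
    qed
    thus ?thesis using yU by (auto simp: closed_cell_def)
  qed
  have y_int: "{i, j} \<subseteq> {a, b, c}" if ij: "(i, j) \<in> off_diag l" "D i j y = of_int m" for i j m
  proof (rule ccontr)
    assume no: "\<not> {i, j} \<subseteq> {a, b, c}"
    \<comment> \<open>Carrying the residue 1 at \<open>a\<close> and \<open>b\<close> into the
      integer part leaves residues in \<open>[0, 1)\<close> that vanish at \<open>a\<close>,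
      \<open>b\<close>, \<open>c\<close> and are positive and distinct elsewhere.\<close>
    define n' where "n' k = N k + (if k = a \<or> k = b then 1 else 0)" for k
    define s' where "s' k = (if k = a \<or> k = b then 0 else s k)" for k
    have eq: "of_int (N k) + s k = of_int (n' k) + s' k" for k by (auto simp: n'_def s'_def s_def)
    have "D i j y \<notin> \<int>"
      unfolding Dy[OF ij(1)] eq
      using no h[of i] h[of j] h_inj[of i j] e ij(1)
      by (intro of_int_diff_notin_Ints) (auto simp: s'_def s_def off_diag_def)
    thus False using ij(2) by simp
  qed
  have Dabc: "D a b y = 1" "D b c y = 1" "D a c y = 2"
    using abc by (auto simp: Dy off_diag_def N_def s_def)
  have Kabc: "K x b a = -1" "K x c b = -1" "K x c a = -2"
    using abc e by (auto simp: Kx off_diag_def N_def r_def)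
  have P: "cell x \<subseteq> P_half_open l \<epsilon>"
  proof
    fix z assume z: "z \<in> cell x"
    have "0 < D i (Suc i) z \<and> D i (Suc i) z \<le> 1" if i: "i \<in> {1..<l}" for i
    proof -
      have ii: "(i, Suc i) \<in> off_diag l" using i by (auto simp: off_diag_def)
      have "K x i (Suc i) = 0"
        unfolding Kx[OF ii] using abc e h[of i] h[of "Suc i"] h_Suc[of i] i
        by (auto simp: N_def r_def)
      thus ?thesis using cellD[OF z ii] cell_less[OF x z ii] by simp
    qed
    thus "z \<in> P_half_open l \<epsilon>"
      using z by (simp add: P_half_open_def simple_root_def D_def cell_def)
  qed
  have ca: "(c, a) \<in> off_diag l" using abc by (auto simp: off_diag_def)
  \<comment> \<open>The hyperplanes through \<open>y\<close> belong to the three pairs and bound the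
    alcove from above at positive levels; so no wall excludes \<open>y\<close> from the upper
    closure.\<close>
  have ceiling: "H \<in> ceilings l \<epsilon> (cell x)" if H: "H \<in> walls l \<epsilon> (cell x)" "y \<in> H" for H
  proof -
    obtain i j m where ij: "H = hyperplane l \<epsilon> (\<epsilon> i - \<epsilon> j) m" "1 \<le> i" "i < j" "j \<le> l"
      using H(1) unfolding walls_def affine_arrangement_def pos_roots_def by blast
    have ji: "(j, i) \<in> off_diag l" "(i, j) \<in> off_diag l" using ij by (auto simp: off_diag_def)
    have Dm: "D i j y = of_int m" using H(2) ij(1) by (simp add: hyperplane_eq)
    have "(i, j) \<in> {(a, b), (b, c), (a, c)}" using y_int[OF ji(2) Dm] ij abc by auto
    hence "m = - K x j i" "0 < m" using Dm Dabc Kabc by auto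
    hence "\<forall>z\<in>cell x. (\<epsilon> i - \<epsilon> j) \<bullet> z < of_int m \<longleftrightarrow> (\<epsilon> i - \<epsilon> j) \<bullet> 0 < of_int m"
      using cellD[OF _ ji(1), of _ x] D_swap[of i j] by (auto simp: D_def)
    moreover have "0 \<notin> hyperplane l \<epsilon> (\<epsilon> i - \<epsilon> j) m" using \<open>0 < m\<close> by (auto simp: hyperplane_def)
    ultimately show ?thesis
      using H(1) pos_rootI[OF ij(2-4), of \<epsilon>] unfolding ij(1) ceilings_def by blast
  qed
  have yUC: "y \<in> upper_closure l \<epsilon> (cell x)"
  proof -
    have "D c a y = of_int (K x c a)" using Dabc Kabc D_swap[of a c y] by simp
    from ex_adjacent_tight[OF x y ca this] obtain u v where
      uv: "(u, v) \<in> off_diag l" "adjacent x u v" "D u v y = of_int (K x u v)" by blast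
    have "\<exists>H\<in>walls l \<epsilon> (cell x). y \<in> H"
    proof (cases "u < v")
      case True
      thus ?thesis using wall_if_adjacent(1)[OF x uv(1,2)] uv(3) yU
        by (intro bexI) (auto simp: hyperplane_eq)
    next
      case False
      hence "v < u" using uv(1) by (auto simp: off_diag_def)
      moreover have "y \<in> {z. D u v z = of_int (K x u v)}" using uv(3) by simp
      ultimately show ?thesis using wall_if_adjacent(2)[OF x uv(1,2)] yU
        unfolding Collect_D_swap[OF x uv(1)] by (intro bexI) (auto simp: hyperplane_eq)
    qed
    then obtain H where H: "H \<in> walls l \<epsilon> (cell x)" "y \<in> H" by blast
    have "y \<in> closure (cell x)" using y closure_cell[OF x] by simp
    thus ?thesis using H ceiling unfolding upper_closure_def by blast
  qed
  have alcove: "cell x \<in> alcoves l \<epsilon>" using x unfolding alcoves_eq by blast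
  have ac: "\<epsilon> a - \<epsilon> c \<in> Psi l \<epsilon> E" using abc root_in_Psi_iff[OF \<epsilon>, of a c] by simp
  have yac: "y \<in> upper_closure l \<epsilon> (cell x) \<inter> hyperplane l \<epsilon> (\<epsilon> a - \<epsilon> c) 2"
    using yUC yU Dabc by (simp add: hyperplane_eq)
  obtain \<beta> m where \<beta>: "\<beta> \<in> Psi l \<epsilon> E" "hyperplane l \<epsilon> \<beta> m \<in> ceilings l \<epsilon> (cell x)" "y \<in> hyperplane l \<epsilon> \<beta> m"
    using W alcove P ac yac unfolding Worpitzky_compatible_def by blast
  obtain i j where ij: "\<beta> = \<epsilon> i - \<epsilon> j" "1 \<le> i" "i < j" "j \<le> l" "{i, j} \<in> E"
    using \<beta>(1) unfolding Psi_iff by blast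
  have Dm: "D i j y = of_int m" using \<beta>(3) ij(1) by (simp add: hyperplane_eq)
  have "{i, j} \<subseteq> {a, b, c}" using y_int[OF _ Dm] ij by (auto simp: off_diag_def)
  \<comment> \<open>Among the three pairs only \<open>{a, c}\<close> is an edge. Its hyperplane is
    no wall, since \<open>K x c a = K x c b + K x b a\<close>.\<close>
  hence "i = a" "j = c" using ij abc by auto
  hence "m = 2" using Dm Dabc by simp
  have "hyperplane l \<epsilon> (\<epsilon> a - \<epsilon> c) 2 \<in> walls l \<epsilon> (cell x)"
    using \<beta>(2) unfolding ij(1) \<open>i = a\<close> \<open>j = c\<close> \<open>m = 2\<close> ceilings_def by auto
  hence "(closed_cell x \<inter> hyperplane l \<epsilon> (\<epsilon> a - \<epsilon> c) 2) facet_of closed_cell x"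
    unfolding walls_def closure_cell[OF x] by blast
  hence "(closed_cell x \<inter> {z. D a c z = of_int 2}) facet_of closed_cell x"
    unfolding closed_cell_Int_hyperplane .
  moreover have "{z. D a c z = of_int 2} = {z. D c a z = of_int (K x c a)}"
    using Kabc by (auto simp: D_swap[of c a])
  ultimately show False
    using not_facet_if_between[OF x, of c b a] abc Kabc by simp
qed

end

theorem theorem3p7:
  fixes l :: nat and E :: "nat set set" and \<epsilon> :: "nat \<Rightarrow> 'a::euclidean_space"
  assumes "l \<ge> 1"
    and "simple_graph {1..l} E"
    and "bij_betw \<epsilon> {1..l} Basis"
  shows "all_equivalent
    [cocomparability_graph {1..l} E \<and> umbrella_free_ordering {1..l} E [1..<l+1],
     umbrella_free_ordering {1..l} E [1..<l+1],
     Worpitzky_compatible l \<epsilon> (Psi l \<epsilon> E),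
     strongly_compatible l \<epsilon> (Psi l \<epsilon> E),
     (\<forall>t::real. poly (chromatic_poly {1..l} E) t =
        t * (\<Sum>k = 1..l. f_coeff l E k * ((t + of_nat l - 1 - of_nat k) gchoose (l - 1)))),
     F_series l E = Y_series {1..l} E,
     (\<forall>(V' :: nat set) E'. simple_graph V' E' \<and> graph_isomorphic {1..l} E V' E' \<longrightarrow>
        F_series l E = Y_series V' E'),
     W_series {1..l} E =
       fps_X * (1 - fps_X) * fps_deriv (F_series l E) + fps_X * of_nat l * F_series l E,
     (\<forall>k\<in>{1..l}. w_coeff {1..l} E k =
        of_nat k * f_coeff l E k + of_nat (l - k + 1) * f_coeff l E (k - 1))]"
proof -
  interpret type_A l \<epsilon> using assms(3) by unfold_locales
  note l = assms(1) and E = assms(2)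
  \<comment> \<open>Equality at \<open>q = l\<close> already excludes an umbrella, and
    umbrella-freeness gives equality for every \<open>q\<close>.\<close>
  have count: "umbrella_free l E \<longleftrightarrow> (\<forall>q. chromatic_count l E q = bound_count l E q)"
    using umbrella_free_if_card_eq[OF E] proper_colorings_eq_bound[OF _ E] by metis
  have i: "cocomparability_graph {1..l} E \<and> umbrella_free l E \<longleftrightarrow> umbrella_free l E"
    using cocomparability_if_umbrella_free by blast
  have iii: "Worpitzky_compatible l \<epsilon> (Psi l \<epsilon> E) \<longleftrightarrow> umbrella_free l E"
    using Worpitzky_compatible_if_umbrella_free umbrella_free_if_Worpitzky_compatible by blast
  have iii': "strongly_compatible l \<epsilon> (Psi l \<epsilon> E) \<longleftrightarrow> umbrella_free l E"
    using strongly_compatible_if_umbrella_free[OF assms(3)] umbrella_free_if_strongly_compatible[OF assms(3)]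
    by blast
  have v: "F_series l E = Y_series {1..l} E \<longleftrightarrow> umbrella_free l E"
    unfolding count by (rule Y_series_eq_F_series_iff[OF l])
  have v': "(\<forall>(V' :: nat set) E'. simple_graph V' E' \<and> graph_isomorphic {1..l} E V' E' \<longrightarrow>
      F_series l E = Y_series V' E') \<longleftrightarrow> umbrella_free l E"
    unfolding v[symmetric] using Y_series_isomorphic E graph_isomorphic_refl by (metis finite_atLeastAtMost)
  have vi: "W_series {1..l} E =
      fps_X * (1 - fps_X) * fps_deriv (F_series l E) + fps_X * of_nat l * F_series l E
      \<longleftrightarrow> umbrella_free l E"
    unfolding count by (rule W_series_eq_iff[OF l])
  have vi': "(\<forall>k\<in>{1..l}. w_coeff {1..l} E k =
      of_nat k * f_coeff l E k + of_nat (l - k + 1) * f_coeff l E (k - 1)) \<longleftrightarrow> umbrella_free l E"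
    using W_series_imp_w_coeff vi w_coeff_imp_count_eq[OF l] umbrella_free_if_card_eq[OF E] by blast
  show ?thesis
    unfolding all_equivalent_def umbrella_free_ordering_upt i iii iii' chromatic_poly_eq_iff[OF l] count[symmetric] v v' vi vi'
    by simp
qed

end
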